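(* Let $N_0\ge 0$ be an integer and $f(x)\in \mathcal{L}_{N_0}(P(x),Q(x))$. Let $N_1,\dots,N_m\geq 0$ be $m$ integers and put $N=\sum_{i=0}^mN_i$. Let $q,C,x,A_1,\dots,A_m$ be nonzero complex numbers such that none of the denominators below vanish. Then $$\bigg(\frac{C}{x}\bigg)^{N_0}\frac{(q,C^2q;q,p)_{N}}{(Cxq,Cq/x;q,p)_{N}}\bigg(\prod_{i=1}^m\frac{(A_ix,A_i/x;q,p)_{N_i}}{(A_iC,A_i/C;q,p)_{N_i}}\bigg)f(x)$$ $$=\sum_{k=0}^{N}q^{k}\,\frac{\theta(C^2q^{2k};p)}{\theta(C^2;p)}\,\frac{(C^2,C/x,Cx,q^{-N};q,p)_{k}}{(q,Cxq,Cq/x,C^2q^{N+1};q,p)_{k}}\,f(Cq^k)\prod_{i=1}^m\frac{(A_iCq^{N_i},Cq/A_i;q,p)_k}{(Cq^{-N_i+1}/A_i,A_iC;q,p)_k}.$$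
   Context: Let $p\in\mathbb{C}$, $|p|<1$. Write $(x;p)_\infty=\prod_{n=0}^\infty(1-xp^n)$. The modified Jacobi theta function is $\theta(x;p)=\prod_{n=0}^{\infty}(1-xp^n)(1-p^{n+1}/x)$ for $x\ne 0$. The theta $q,p$-shifted factorial is $(x;q,p)_n=\prod_{k=0}^{n-1}\theta(xq^k;p)$, and $(x_1,\dots,x_r;q,p)_n=\prod_{k=1}^r(x_k;q,p)_n$. Empty products equal $1$. Define $P(x)=\theta(-x^2;p^2)\,(-p;p)_\infty$ and $Q(x)=x\,\theta(-px^2;p^2)\,(-p;p)_\infty$ for $x\ne0$, where $\theta(-px^2;p^2)=\prod_{n\ge 0}(1+p^{2n+1}x^2)(1+p^{2n+1}/x^2)$. For an integer $M\ge 0$, $\mathcal{L}_M(P(x),Q(x))$ denotes the set of all functions of the form $\sum_{k=0}^{M}\lambda_kP(x)^kQ(x)^{M-k}$ with complex coefficients $\lambda_k$ independent of $x$ ("elliptic Askey-Wilson polynomials of degree $M$"). *)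

theory Defs
  imports "HOL-Analysis.Analysis"
begin

definition qpoch_inf :: "complex \<Rightarrow> complex \<Rightarrow> complex" where
  "qpoch_inf x p = (\<Prod>n. 1 - x * p ^ n)"

(* Only meaningful for x \<noteq> 0 and norm p < 1; p = 0 is allowed (0 ^ 0 = 1) and gives 1 - x. *)
definition mtheta :: "complex \<Rightarrow> complex \<Rightarrow> complex" where
  "mtheta x p = (\<Prod>n. (1 - x * p ^ n) * (1 - p ^ (n + 1) / x))"

definition theta_fact :: "complex \<Rightarrow> complex \<Rightarrow> complex \<Rightarrow> nat \<Rightarrow> complex" where
  "theta_fact x q p n = (\<Prod>k<n. mtheta (x * q ^ k) p)"

(* The multi-parameter symbol (x_1, ..., x_r; q, p)_n. *)
definition theta_facts :: "complex list \<Rightarrow> complex \<Rightarrow> complex \<Rightarrow> nat \<Rightarrow> complex" where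
  "theta_facts xs q p n = (\<Prod>x\<leftarrow>xs. theta_fact x q p n)"

definition aw_P :: "complex \<Rightarrow> complex \<Rightarrow> complex" where
  "aw_P p x = mtheta (- (x ^ 2)) (p ^ 2) * qpoch_inf (- p) p"

(* For p = 0 the first argument of mtheta below is 0, outside its natural domain. The lemma
   mtheta_aw_Q shows that the intended product expansion holds in that case as well. *)
definition aw_Q :: "complex \<Rightarrow> complex \<Rightarrow> complex" where
  "aw_Q p x = x * mtheta (- p * x ^ 2) (p ^ 2) * qpoch_inf (- p) p"

lemma mtheta_aw_Q:
  "mtheta (- p * x ^ 2) (p ^ 2) =
     (\<Prod>n. (1 + p ^ (2 * n + 1) * x ^ 2) * (1 + p ^ (2 * n + 1) / x ^ 2))"
proof -
  have "(1 - (- p * x ^ 2) * (p ^ 2) ^ n) * (1 - (p ^ 2) ^ (n + 1) / (- p * x ^ 2)) =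
        (1 + p ^ (2 * n + 1) * x ^ 2) * (1 + p ^ (2 * n + 1) / x ^ 2)" for n
  proof -
    have "(p ^ 2) ^ (n + 1) = p * p ^ (2 * n + 1)"
      by (simp add: power_mult power2_eq_square)
    hence "(p ^ 2) ^ (n + 1) / (- p * x ^ 2) = - (p ^ (2 * n + 1) / x ^ 2)"
      by (cases "p = 0") auto
    moreover have "(- p * x ^ 2) * (p ^ 2) ^ n = - (p ^ (2 * n + 1) * x ^ 2)"
      by (simp add: power_mult [symmetric])
    ultimately show ?thesis by simp
  qed
  thus ?thesis by (simp only: mtheta_def)
qed

(* Elements are functions of x \<noteq> 0; the value of the total function f at 0 is irrelevant. *)
definition elliptic_aw :: "nat \<Rightarrow> complex \<Rightarrow> (complex \<Rightarrow> complex) set" where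
  "elliptic_aw M p = {f. \<exists>c :: nat \<Rightarrow> complex. \<forall>x. x \<noteq> 0 \<longrightarrow>
     f x = (\<Sum>k\<le>M. c k * aw_P p x ^ k * aw_Q p x ^ (M - k))}"

end

theory Submission
  imports Defs
begin

text \<open>
  The formula is Lagrange interpolation with theta functions in place of polynomials.

  Put \<open>E a y = mtheta (a * y) p * mtheta (a / y) p / a\<close>. Weierstrass' addition formula says that this
  bracket is a determinant \<open>Y a * X y - X a * Y y\<close> of two functions (\<open>theta_bracket_rank_two\<close>), so it
  behaves like \<open>a - y\<close> written in homogeneous coordinates \<open>X\<close>, \<open>Y\<close>. The proof expands the theta function
  into its Laurent series, whose coefficients are found from Euler's series for the infinite product
  (\<open>theta_coeff_rec\<close>), and splits the product of two such series by parity (\<open>jacobi_product\<close>).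

  Call a sum of products of \<open>n\<close> linear combinations of \<open>X\<close> and \<open>Y\<close> a theta polynomial of degree \<open>n\<close>. It
  is determined by its values at \<open>n + 1\<close> points whose mutual brackets do not vanish
  (\<open>theta_lagrange_interpolation\<close>). Now divide \<open>f\<close> by \<open>x ^ N 0\<close> and multiply by all the pairs
  \<open>mtheta (A i * x * q ^ l) p * mtheta (A i / x * q ^ l) p\<close> with \<open>l < N i\<close>. Each pair is a multiple of a
  bracket, and so are \<open>aw_P p x / x\<close> and, for \<open>p \<noteq> 0\<close>, \<open>aw_Q p x / x\<close>, which is a constant for
  \<open>p = 0\<close>; in any case the result is a theta polynomial of degree \<open>N 0 + \<dots> + N m\<close>. Its
  interpolation at the nodes \<open>C * q ^ k\<close> is the asserted formula: the very-well-poised part of the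
  summand is the Lagrange weight (\<open>lagrange_weight\<close>), and the remaining factors are the values at the
  nodes (\<open>theta_facts_ratio\<close>).

  Both sides may make sense although two nodes coincide, or a node coincides with \<open>x\<close>. These cases
  follow by continuity in \<open>C\<close>, since the exceptional values of \<open>C\<close> are countable (\<open>elliptic_sum\<close>).
\<close>

section \<open>Euler's series and the theta function\<close>

text \<open>
  The Taylor coefficient of \<open>qpoch_inf x p\<close> at \<open>x ^ n\<close>, which is
  \<open>(-1) ^ n * p ^ (n choose 2) / (\<Prod>k=1..n. 1 - p ^ k)\<close>. The recursive form is the one that
  the functional equation of the product dictates.
\<close>

primrec euler_coeff :: "complex \<Rightarrow> nat \<Rightarrow> complex" where
  "euler_coeff p 0 = 1"
| "euler_coeff p (Suc n) = - (p ^ n / (1 - p ^ Suc n)) * euler_coeff p n"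

lemma one_minus_power_nonzero:
  fixes p :: complex
  assumes "norm p < 1"
  shows "1 - p ^ Suc n \<noteq> 0"
proof
  assume "1 - p ^ Suc n = 0"
  hence "norm (p ^ Suc n) = 1" by simp
  moreover have "norm (p ^ Suc n) < 1"
    using assms by (simp add: norm_power power_less_one_iff del: power_Suc)
  ultimately show False by simp
qed

lemma euler_coeff_rec:
  assumes "norm p < 1"
  shows "euler_coeff p (Suc n) * (1 - p ^ Suc n) = - (p ^ n) * euler_coeff p n"
  using one_minus_power_nonzero[OF assms, of n] by simp

declare euler_coeff.simps(2) [simp del]

lemma summable_norm_euler:
  assumes "norm p < 1"
  shows "summable (\<lambda>n. norm (euler_coeff p n * x ^ n))"
proof -
  have "(\<lambda>n. p ^ n / (1 - p ^ Suc n) * x) \<longlonglongrightarrow> 0 / (1 - 0) * x"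
    using assms by (intro tendsto_intros LIMSEQ_power_zero LIMSEQ_Suc) auto
  hence "(\<lambda>n. norm (p ^ n / (1 - p ^ Suc n) * x)) \<longlonglongrightarrow> 0"
    using tendsto_norm_zero by fastforce
  hence "\<forall>\<^sub>F n in sequentially. norm (p ^ n / (1 - p ^ Suc n) * x) < 1 / 2"
    by (rule order_tendstoD) simp
  then obtain M where M: "\<And>n. n \<ge> M \<Longrightarrow> norm (p ^ n / (1 - p ^ Suc n) * x) < 1 / 2"
    by (auto simp: eventually_sequentially)
  show ?thesis
  proof (rule summable_ratio_test[of "1/2" M])
    fix n assume n: "n \<ge> M"
    have "norm (norm (euler_coeff p (Suc n) * x ^ Suc n))
        = norm (p ^ n / (1 - p ^ Suc n) * x) * norm (euler_coeff p n * x ^ n)"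
      by (simp add: norm_mult norm_divide norm_power euler_coeff.simps)
    also have "\<dots> \<le> 1 / 2 * norm (euler_coeff p n * x ^ n)"
      using M[OF n] by (intro mult_right_mono) auto
    finally show "norm (norm (euler_coeff p (Suc n) * x ^ Suc n))
        \<le> 1 / 2 * norm (norm (euler_coeff p n * x ^ n))" by simp
  qed simp
qed

lemma summable_euler:
  assumes "norm p < 1"
  shows "summable (\<lambda>n. euler_coeff p n * x ^ n)"
  using summable_norm_euler[OF assms] by (rule summable_norm_cancel)

definition euler_series :: "complex \<Rightarrow> complex \<Rightarrow> complex" where
  "euler_series p x = (\<Sum>n. euler_coeff p n * x ^ n)"

lemma isCont_euler_series:
  assumes "norm p < 1"
  shows "isCont (euler_series p) x"
  unfolding euler_series_def
  by (rule isCont_powser_converges_everywhere) (rule summable_euler[OF assms])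

text \<open>
  Comparing coefficients turns the recursion of the coefficients into the functional equation that
  the infinite product satisfies by removing its first factor.
\<close>

lemma euler_series_step:
  assumes p: "norm p < 1"
  shows "euler_series p x = (1 - x) * euler_series p (p * x)"
proof -
  let ?a = "euler_coeff p"
  have s: "summable (\<lambda>n. ?a n * x ^ n)" "summable (\<lambda>n. ?a n * (p * x) ^ n)"
    by (rule summable_euler[OF p])+
  have s': "summable (\<lambda>n. ?a (Suc n) * (p * x) ^ Suc n)"
    using s(2) summable_Suc_iff[of "\<lambda>n. ?a n * (p * x) ^ n"] by simp
  have "euler_series p x - 1 = (\<Sum>n. ?a (Suc n) * x ^ Suc n)"
    unfolding euler_series_def using suminf_split_head[OF s(1)] by simp
  also have "\<dots> = (\<Sum>n. ?a (Suc n) * (p * x) ^ Suc n - x * (?a n * (p * x) ^ n))"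
  proof (rule suminf_cong)
    fix n
    have "?a (Suc n) = ?a (Suc n) * p ^ Suc n - p ^ n * ?a n"
      using euler_coeff_rec[OF p, of n] by (simp add: algebra_simps)
    hence "?a (Suc n) * x ^ Suc n = (?a (Suc n) * p ^ Suc n - p ^ n * ?a n) * x ^ Suc n"
      by simp
    thus "?a (Suc n) * x ^ Suc n = ?a (Suc n) * (p * x) ^ Suc n - x * (?a n * (p * x) ^ n)"
      by (simp add: power_mult_distrib algebra_simps)
  qed
  also have "\<dots> = (\<Sum>n. ?a (Suc n) * (p * x) ^ Suc n) - (\<Sum>n. x * (?a n * (p * x) ^ n))"
    by (rule suminf_diff[symmetric]) (use s' s(2) in \<open>auto intro: summable_mult\<close>)
  also have "(\<Sum>n. ?a (Suc n) * (p * x) ^ Suc n) = euler_series p (p * x) - 1"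
    unfolding euler_series_def using suminf_split_head[OF s(2)] by simp
  also have "(\<Sum>n. x * (?a n * (p * x) ^ n)) = x * euler_series p (p * x)"
    unfolding euler_series_def by (rule suminf_mult[OF s(2)])
  finally show ?thesis by (simp add: algebra_simps)
qed

lemma convergent_prod_qpoch:
  fixes p :: complex
  assumes "norm p < 1"
  shows "convergent_prod (\<lambda>n. 1 - x * p ^ n)"
proof (rule abs_convergent_prod_imp_convergent_prod)
  have "summable (\<lambda>n. norm x * norm p ^ n)"
    using assms by (intro summable_mult summable_geometric) auto
  thus "abs_convergent_prod (\<lambda>n. 1 - x * p ^ n)"
    by (simp add: abs_convergent_prod_conv_summable norm_mult norm_power)
qed

text \<open>
  Iterating the functional equation peels off the factors of the product one by one; the remaining
  argument \<open>p ^ n * x\<close> tends to \<open>0\<close>, where the series is \<open>1\<close>. Continuity of the product and its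
  Laurent expansion both come from this identity.
\<close>

lemma qpoch_inf_eq_euler_series:
  assumes p: "norm p < 1"
  shows "qpoch_inf x p = euler_series p x"
proof -
  have iter: "euler_series p x = (\<Prod>i<n. 1 - x * p ^ i) * euler_series p (p ^ n * x)" for n
  proof (induction n)
    case (Suc n)
    show ?case
      by (subst Suc, subst euler_series_step[OF p]) (simp add: mult_ac)
  qed simp
  have "(\<lambda>n. p ^ Suc n * x) \<longlonglongrightarrow> 0 * x"
    using p by (intro tendsto_intros LIMSEQ_Suc LIMSEQ_power_zero) auto
  hence "(\<lambda>n. euler_series p (p ^ Suc n * x)) \<longlonglongrightarrow> euler_series p 0"
    using isCont_tendsto_compose[OF isCont_euler_series[OF p]] by force
  moreover have "euler_series p 0 = 1"
    unfolding euler_series_def by (simp add: powser_zero)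
  moreover have "(\<lambda>n. \<Prod>i\<le>n. 1 - x * p ^ i) \<longlonglongrightarrow> qpoch_inf x p"
    unfolding qpoch_inf_def by (rule convergent_prod_LIMSEQ[OF convergent_prod_qpoch[OF p]])
  ultimately have "(\<lambda>n. (\<Prod>i\<le>n. 1 - x * p ^ i) * euler_series p (p ^ Suc n * x))
      \<longlonglongrightarrow> qpoch_inf x p * 1"
    using tendsto_mult by fastforce
  moreover have "(\<Prod>i\<le>n. 1 - x * p ^ i) * euler_series p (p ^ Suc n * x) = euler_series p x" for n
    using iter[of "Suc n"] by (simp add: lessThan_Suc_atMost)
  ultimately have "(\<lambda>_::nat. euler_series p x) \<longlonglongrightarrow> qpoch_inf x p" by simp
  thus ?thesis by (simp add: LIMSEQ_const_iff)
qed

lemma mtheta_eq_qpoch: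
  assumes p: "norm p < 1"
  shows "mtheta x p = qpoch_inf x p * qpoch_inf (p / x) p"
  unfolding mtheta_def qpoch_inf_def
  by (subst prodinf_mult[OF convergent_prod_qpoch[OF p] convergent_prod_qpoch[OF p]]) simp

lemma continuous_mtheta:
  assumes p: "norm p < 1" and "x \<noteq> 0"
  shows "isCont (\<lambda>x. mtheta x p) x"
proof -
  have "isCont (\<lambda>x. euler_series p x * euler_series p (p / x)) x"
    by (intro continuous_intros isCont_euler_series[OF p] isCont_o2[OF _ isCont_euler_series[OF p]])
       (use assms in auto)
  thus ?thesis by (simp add: mtheta_eq_qpoch[OF p] qpoch_inf_eq_euler_series[OF p])
qed

text \<open>
  Apart from its factor \<open>1 - x\<close>, the theta product is invariant under inversion of \<open>x\<close>, and
  \<open>1 - 1 / x = - (1 / x) * (1 - x)\<close>.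
\<close>

lemma mtheta_inverse:
  assumes p: "norm p < 1" and x: "x \<noteq> 0"
  shows "mtheta (1 / x) p = - (1 / x) * mtheta x p"
proof -
  have 1: "qpoch_inf y p = (1 - y) * qpoch_inf (p * y) p" for y
    using euler_series_step[OF p, of y] by (simp add: qpoch_inf_eq_euler_series[OF p])
  have "mtheta (1 / x) p = (1 - 1 / x) * qpoch_inf (p / x) p * qpoch_inf (p * x) p"
    using 1[of "1 / x"] by (simp add: mtheta_eq_qpoch[OF p])
  also have "\<dots> = - (1 / x) * ((1 - x) * qpoch_inf (p * x) p * qpoch_inf (p / x) p)"
    using x by (simp add: field_simps)
  also have "\<dots> = - (1 / x) * mtheta x p"
    using 1[of x] by (simp add: mtheta_eq_qpoch[OF p])
  finally show ?thesis .
qed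

text \<open>
  A convergent product vanishes only through one of its factors. Countability makes the
  complement of the zero set dense, which serves to remove genericity conditions by continuity.
\<close>

lemma countable_mtheta_zeros:
  assumes p: "norm p < 1"
  shows "countable {x. x \<noteq> 0 \<and> mtheta x p = 0}"
proof (rule countable_subset)
  have nz: "\<exists>n. x * p ^ n = 1" if "qpoch_inf x p = 0" for x
  proof (rule ccontr)
    assume "\<nexists>n. x * p ^ n = 1"
    hence "1 - x * p ^ n \<noteq> 0" for n by auto
    from prodinf_nonzero[OF convergent_prod_qpoch[OF p] this] that show False
      by (simp add: qpoch_inf_def)
  qed
  show "{x. x \<noteq> 0 \<and> mtheta x p = 0} \<subseteq> range (\<lambda>n. 1 / p ^ n) \<union> range (\<lambda>n. p * p ^ n)"
  proof
    fix x assume "x \<in> {x. x \<noteq> 0 \<and> mtheta x p = 0}"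
    hence x: "x \<noteq> 0" and "qpoch_inf x p = 0 \<or> qpoch_inf (p / x) p = 0"
      by (auto simp: mtheta_eq_qpoch[OF p])
    then consider n where "x * p ^ n = 1" | n where "p / x * p ^ n = 1"
      using nz by blast
    thus "x \<in> range (\<lambda>n. 1 / p ^ n) \<union> range (\<lambda>n. p * p ^ n)"
    proof cases
      case 1
      hence "p ^ n \<noteq> 0" by (metis mult_zero_right zero_neq_one)
      hence "x = 1 / p ^ n" using 1 by (simp add: eq_divide_eq)
      thus ?thesis by blast
    next
      case 2 hence "x = p * p ^ n" using x by (simp add: field_simps)
      thus ?thesis by blast
    qed
  qed
qed auto

section \<open>The Laurent expansion of the theta function\<close>

text \<open>
  Extended by \<open>0\<close> to negative indices, the Euler coefficients satisfy their recursion on all of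
  \<open>int\<close> (at \<open>n = -1\<close> because \<open>1 - p powi 0 = 0\<close>), so sums over \<open>int\<close> can be shifted without boundary
  terms.
\<close>

definition euler_coeff_int :: "complex \<Rightarrow> int \<Rightarrow> complex" where
  "euler_coeff_int p n = (if n < 0 then 0 else euler_coeff p (nat n))"

lemma euler_coeff_int_rec:
  assumes p: "norm p < 1"
  shows "euler_coeff_int p (n + 1) * (1 - p powi (n + 1)) = - (p powi n) * euler_coeff_int p n"
proof -
  consider "n < -1" | "n = -1" | "n \<ge> 0" by linarith
  thus ?thesis
  proof cases
    case 3
    then obtain m where m: "n = int m" by (metis nonneg_int_cases)
    have "nat (int m + 1) = Suc m" "p powi (int m + 1) = p ^ Suc m"
      by (auto simp: power_int_def nat_add_distrib)
    thus ?thesis using euler_coeff_rec[OF p, of m]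
      by (simp add: euler_coeff_int_def m)
  qed (auto simp: euler_coeff_int_def)
qed

lemma not_range_int_imp_neg: "n \<notin> range int \<Longrightarrow> n < 0"
  by (metis nonneg_int_cases not_less rangeI)

lemma euler_int_abs_summable:
  assumes p: "norm p < 1"
  shows "(\<lambda>n. norm (euler_coeff_int p n * x powi n)) summable_on UNIV"
proof -
  have "(\<lambda>n::nat. norm (euler_coeff p n * x ^ n)) summable_on UNIV"
    using norm_summable_imp_summable_on[of "\<lambda>n. norm (euler_coeff p n * x ^ n)"]
      summable_norm_euler[OF p] by simp
  hence "((\<lambda>n. norm (euler_coeff_int p n * x powi n)) \<circ> int) summable_on UNIV"
    by (simp add: o_def euler_coeff_int_def)
  hence "(\<lambda>n. norm (euler_coeff_int p n * x powi n)) summable_on range int"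
    by (subst summable_on_reindex) auto
  thus ?thesis
    by (rule summable_on_cong_neutral[THEN iffD1, rotated -1])
       (auto simp: euler_coeff_int_def dest: not_range_int_imp_neg)
qed

lemma qpoch_inf_int_series:
  assumes p: "norm p < 1"
  shows "qpoch_inf x p = (\<Sum>\<^sub>\<infinity>n. euler_coeff_int p n * x powi n)"
proof -
  have "((\<lambda>n::nat. euler_coeff p n * x ^ n) has_sum euler_series p x) UNIV"
    unfolding euler_series_def
    by (rule norm_summable_imp_has_sum[OF summable_norm_euler[OF p]])
       (rule summable_sums[OF summable_euler[OF p]])
  hence "euler_series p x = (\<Sum>\<^sub>\<infinity>n. euler_coeff_int p (int n) * x powi int n)"
    by (simp add: infsumI euler_coeff_int_def)
  also have "\<dots> = (\<Sum>\<^sub>\<infinity>n\<in>range int. euler_coeff_int p n * x powi n)"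
    by (subst infsum_reindex) (auto simp: o_def)
  also have "\<dots> = (\<Sum>\<^sub>\<infinity>n. euler_coeff_int p n * x powi n)"
    by (rule infsum_cong_neutral)
       (auto simp: euler_coeff_int_def dest: not_range_int_imp_neg)
  finally show ?thesis by (simp add: qpoch_inf_eq_euler_series[OF p])
qed

lemma product_summable:
  fixes f g :: "int \<Rightarrow> complex"
  assumes "(\<lambda>i. norm (f i)) summable_on UNIV" "(\<lambda>k. norm (g k)) summable_on UNIV"
  shows "(\<lambda>(i, k). f i * g k) summable_on UNIV"
proof -
  have "(\<lambda>ik. norm ((\<lambda>(i, k). f i * g k) ik)) summable_on (UNIV \<times> UNIV)"
    using assms
    by (subst Infinite_Sum.abs_summable_on_Sigma_iff)
       (auto simp: norm_mult infsum_cmult_right' abs_mult infsum_nonneg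
             intro!: summable_on_cmult_right summable_on_cmult_left)
  thus ?thesis using abs_summable_summable by force
qed

lemma infsum_product:
  fixes f g :: "int \<Rightarrow> complex"
  assumes "(\<lambda>(i, k). f i * g k) summable_on UNIV"
  shows "(\<Sum>\<^sub>\<infinity>(i, k). f i * g k) = (\<Sum>\<^sub>\<infinity>i. f i) * (\<Sum>\<^sub>\<infinity>k. g k)"
proof -
  have "(\<Sum>\<^sub>\<infinity>(i, k). f i * g k) = (\<Sum>\<^sub>\<infinity>i. \<Sum>\<^sub>\<infinity>k. f i * g k)"
    using infsum_Sigma'_banach[of "\<lambda>i k. f i * g k" UNIV "\<lambda>_. UNIV"] assms by simp
  thus ?thesis by (simp add: infsum_cmult_right' infsum_cmult_left')
qed

lemma infsum_minus:
  fixes f g :: "'a \<Rightarrow> complex"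
  assumes "f summable_on A" "g summable_on A"
  shows "infsum (\<lambda>x. f x - g x) A = infsum f A - infsum g A"
  using infsum_add[of f A "\<lambda>x. - g x"] assms
  by (simp add: infsum_uminus summable_on_uminus)

text \<open>
  The coefficient of \<open>x powi n\<close> in the product of the Euler series at \<open>x\<close> and at \<open>p / x\<close>.
\<close>

definition theta_coeff :: "complex \<Rightarrow> int \<Rightarrow> complex" where
  "theta_coeff p n = (\<Sum>\<^sub>\<infinity>k. euler_coeff_int p (n + k) * euler_coeff_int p k * p powi k)"

text \<open>
  The product of two Euler series is an absolutely convergent double series; the substitution
  \<open>i = n + k\<close> collects the terms with a common difference of the two indices.
\<close>

lemma euler_double_summable:
  assumes p: "norm p < 1" and x: "x \<noteq> 0"
  shows "(\<lambda>(n, k). euler_coeff_int p (n + k) * x powi (n + k) * (euler_coeff_int p k * y powi k))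
    summable_on UNIV"
    and "qpoch_inf x p * qpoch_inf y p =
      (\<Sum>\<^sub>\<infinity>(n, k). euler_coeff_int p (n + k) * x powi (n + k) * (euler_coeff_int p k * y powi k))"
proof -
  let ?f = "\<lambda>i. euler_coeff_int p i * x powi i" and ?g = "\<lambda>k. euler_coeff_int p k * y powi k"
  have b: "bij_betw (\<lambda>(n, k). (n + k, k)) (UNIV :: (int \<times> int) set) UNIV"
    by (rule bij_betwI[where g = "\<lambda>(n, k). (n - k, k)"]) auto
  have s: "(\<lambda>(i, k). ?f i * ?g k) summable_on UNIV"
    by (intro product_summable euler_int_abs_summable[OF p])
  show "(\<lambda>(n, k). ?f (n + k) * ?g k) summable_on UNIV"
    using summable_on_reindex_bij_betw[OF b, of "\<lambda>(i, k). ?f i * ?g k"] s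
    by (simp add: case_prod_unfold)
  have "(\<Sum>\<^sub>\<infinity>(n, k). ?f (n + k) * ?g k) = (\<Sum>\<^sub>\<infinity>(i, k). ?f i * ?g k)"
    using infsum_reindex_bij_betw[OF b, of "\<lambda>(i, k). ?f i * ?g k"]
    by (simp add: case_prod_unfold)
  thus "qpoch_inf x p * qpoch_inf y p = (\<Sum>\<^sub>\<infinity>(n, k). ?f (n + k) * ?g k)"
    by (simp add: infsum_product[OF s] qpoch_inf_int_series[OF p])
qed

lemma euler_row_summable:
  assumes p: "norm p < 1"
  shows "(\<lambda>k. euler_coeff_int p (n + k) * euler_coeff_int p k * y powi k) summable_on UNIV"
proof -
  have "(\<lambda>(n, k). euler_coeff_int p (n + k) * (euler_coeff_int p k * y powi k))
    summable_on (UNIV \<times> UNIV)"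
    using euler_double_summable(1)[OF p, of 1 y] by simp
  from summable_on_SigmaD1[OF this, of n] show ?thesis by (simp add: mult.assoc)
qed

lemma mtheta_laurent:
  assumes p: "norm p < 1" "p \<noteq> 0" and x: "x \<noteq> 0"
  shows "(\<lambda>n. theta_coeff p n * x powi n) summable_on UNIV"
    and "mtheta x p = (\<Sum>\<^sub>\<infinity>n. theta_coeff p n * x powi n)"
proof -
  let ?h = "\<lambda>n k. euler_coeff_int p (n + k) * x powi (n + k) * (euler_coeff_int p k * (p / x) powi k)"
  have h: "?h n k = euler_coeff_int p (n + k) * euler_coeff_int p k * p powi k * x powi n" for n k
    using x p by (simp add: power_int_add power_int_divide_distrib)
  have inner: "(\<Sum>\<^sub>\<infinity>k. ?h n k) = theta_coeff p n * x powi n" for n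
    unfolding h theta_coeff_def by (rule infsum_cmult_left')
  have s: "(\<lambda>(n, k). ?h n k) summable_on (UNIV \<times> UNIV)"
    using euler_double_summable(1)[OF p(1) x, of "p / x"] by simp
  show "(\<lambda>n. theta_coeff p n * x powi n) summable_on UNIV"
    using summable_on_Sigma_banach[OF s] unfolding inner .
  show "mtheta x p = (\<Sum>\<^sub>\<infinity>n. theta_coeff p n * x powi n)"
    using infsum_Sigma'_banach[OF s] unfolding inner
    by (simp add: mtheta_eq_qpoch[OF p(1)] euler_double_summable(2)[OF p(1) x])
qed

text \<open>
  This is the recursion equivalent to \<open>mtheta (p * x) p = - mtheta x p / x\<close>, but it is derived on
  the coefficients, so that no uniqueness theorem for Laurent series is needed. Write
  \<open>S n = (\<Sum>k. a (n + k) * a k * p powi (2 * k))\<close>, where \<open>a\<close> are the Euler coefficients. Their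
  recursion, applied to \<open>a (n + 1 + k)\<close>, expresses \<open>theta_coeff p (n + 1)\<close> through \<open>S (n + 1)\<close> and
  \<open>S n\<close>; applied to \<open>a k\<close> in \<open>S (n + 1)\<close>, followed by a shift of \<open>k\<close>, it expresses \<open>S (n + 1)\<close>
  through \<open>theta_coeff p n\<close> and \<open>S n\<close>. The terms \<open>S n\<close> cancel.
\<close>

lemma theta_coeff_rec:
  assumes p: "norm p < 1" "p \<noteq> 0"
  shows "theta_coeff p (n + 1) = - (p powi n) * theta_coeff p n"
proof -
  let ?a = "euler_coeff_int p"
  define S where "S n = (\<Sum>\<^sub>\<infinity>k. ?a (n + k) * ?a k * (p ^ 2) powi k)" for n
  note row = euler_row_summable[OF p(1)]
  have rec: "?a (m + 1) = ?a (m + 1) * p powi (m + 1) - p powi m * ?a m" for m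
    using euler_coeff_int_rec[OF p(1), of m] by (simp add: algebra_simps)
  have p2: "(p ^ 2) powi k = p powi k * p powi k" for k
    by (simp add: power2_eq_square power_int_mult_distrib)
  have "theta_coeff p (n + 1) = (\<Sum>\<^sub>\<infinity>k. p powi (n + 1) * (?a (n + 1 + k) * ?a k * (p ^ 2) powi k)
        - p powi n * (?a (n + k) * ?a k * (p ^ 2) powi k))"
    unfolding theta_coeff_def
  proof (rule infsum_cong)
    fix k
    have "?a (n + 1 + k) = ?a (n + 1 + k) * p powi (n + 1 + k) - p powi (n + k) * ?a (n + k)"
      using rec[of "n + k"] by (simp add: algebra_simps)
    hence "?a (n + 1 + k) * ?a k * p powi k
        = (?a (n + 1 + k) * p powi (n + 1 + k) - p powi (n + k) * ?a (n + k)) * ?a k * p powi k"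
      by simp
    thus "?a (n + 1 + k) * ?a k * p powi k
        = p powi (n + 1) * (?a (n + 1 + k) * ?a k * (p ^ 2) powi k)
        - p powi n * (?a (n + k) * ?a k * (p ^ 2) powi k)"
      using p(2) by (simp add: p2 power_int_add algebra_simps)
  qed
  also have "\<dots> = p powi (n + 1) * S (n + 1) - p powi n * S n"
    unfolding S_def
    by (subst infsum_minus) (auto intro!: summable_on_cmult_right row simp: infsum_cmult_right')
  finally have 1: "theta_coeff p (n + 1) = p powi (n + 1) * S (n + 1) - p powi n * S n" .
  let ?G = "\<lambda>k. ?a (n + k) * ?a k * p powi k - ?a (n + k) * ?a k * (p ^ 2) powi k"
  \<comment> \<open>\<open>?G k\<close> contains the factor \<open>1 - p powi k\<close>, so the recursion at \<open>k + 1\<close> applies after the shift.\<close>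
  have b: "bij_betw (\<lambda>k::int. k + 1) UNIV UNIV"
    by (rule bij_betwI[where g = "\<lambda>k. k - 1"]) auto
  have "p * S (n + 1) = (\<Sum>\<^sub>\<infinity>k. - ?G (k + 1))"
    unfolding S_def infsum_cmult_right'[symmetric]
  proof (rule infsum_cong)
    fix k
    have e: "p powi k * ?a k = - (?a (k + 1) * (1 - p powi (k + 1)))"
      using euler_coeff_int_rec[OF p(1), of k] by simp
    have "p * (?a (n + 1 + k) * ?a k * (p ^ 2) powi k)
        = ?a (n + 1 + k) * p powi (k + 1) * (p powi k * ?a k)"
      using p(2) by (simp add: p2 power_int_add)
    thus "p * (?a (n + 1 + k) * ?a k * (p ^ 2) powi k) = - ?G (k + 1)"
      unfolding e by (simp add: p2 algebra_simps)
  qed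
  also have "\<dots> = - (\<Sum>\<^sub>\<infinity>k. ?G k)"
    using infsum_reindex_bij_betw[OF b, of ?G] by (simp only: infsum_uminus)
  also have "(\<Sum>\<^sub>\<infinity>k. ?G k) = theta_coeff p n - S n"
    unfolding S_def theta_coeff_def by (rule infsum_minus) (rule row)+
  finally have "p * S (n + 1) = - (theta_coeff p n - S n)" .
  hence "p powi n * (p * S (n + 1)) = - (p powi n) * (theta_coeff p n - S n)"
    by (simp add: right_diff_distrib)
  thus ?thesis unfolding 1 using p(2) by (simp add: power_int_add algebra_simps)
qed

text \<open>
  The coefficients in Jacobi's triple product identity, which are those of the theta function
  normalised to \<open>1\<close> at \<open>n = 0\<close>.
\<close>

definition jacobi_coeff :: "complex \<Rightarrow> int \<Rightarrow> complex" where
  "jacobi_coeff p n = (-1) powi n * p powi (n * (n - 1) div 2)"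

lemma theta_coeff_closed:
  assumes p: "norm p < 1" "p \<noteq> 0"
  shows "theta_coeff p n = theta_coeff p 0 * jacobi_coeff p n"
proof -
  have J: "jacobi_coeff p (n + 1) = - (p powi n) * jacobi_coeff p n" for n
  proof -
    have "(n + 1) * n = n * (n - 1) + n * 2" by (simp add: algebra_simps)
    hence "(n + 1) * n div 2 = n * (n - 1) div 2 + n" by simp
    thus ?thesis using p(2) by (simp add: jacobi_coeff_def power_int_add)
  qed
  show ?thesis
  proof (induction n rule: int_induct[where k = 0])
    case base show ?case by (simp add: jacobi_coeff_def)
  next
    case (step1 i) thus ?case by (simp add: theta_coeff_rec[OF p] J)
  next
    case (step2 i)
    have "theta_coeff p i = - (p powi (i - 1)) * theta_coeff p (i - 1)"
      "jacobi_coeff p i = - (p powi (i - 1)) * jacobi_coeff p (i - 1)"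
      using theta_coeff_rec[OF p, of "i - 1"] J[of "i - 1"] by simp_all
    with step2(2) p(2) show ?case by simp
  qed
qed

lemma jacobi_coeff_mult:
  assumes "p \<noteq> 0"
  shows "jacobi_coeff p m * jacobi_coeff p n
    = (-1) powi (m + n) * p powi (m * (m - 1) div 2 + n * (n - 1) div 2)"
  using assms by (simp add: jacobi_coeff_def power_int_add)

lemma half_add_half:
  fixes a b c :: int
  assumes "even a" "even b" "a + b = 2 * c"
  shows "a div 2 + b div 2 = c"
  using assms by presburger

text \<open>
  In the coordinates \<open>m = i + j\<close>, \<open>n = i - j\<close> (or \<open>m = i + j + 1\<close>, \<open>n = i - j\<close>) the quadratic form in the
  exponent becomes diagonal, so the product of two coefficients separates.
\<close>

lemma jacobi_coeff_even:
  assumes "p \<noteq> 0"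
  shows "jacobi_coeff p (i + j) * jacobi_coeff p (i - j) = p powi (i * i - i) * p powi (j * j)"
proof -
  have "even ((i + j) * (i + j - 1))" "even ((i - j) * (i - j - 1))" by auto
  moreover have "(i + j) * (i + j - 1) + (i - j) * (i - j - 1) = 2 * (i * i - i + j * j)"
    by (simp add: algebra_simps)
  ultimately have e: "(i + j) * (i + j - 1) div 2 + (i - j) * (i - j - 1) div 2 = i * i - i + j * j"
    by (rule half_add_half)
  have s: "(-1 :: complex) powi (i + j + (i - j)) = 1"
    by simp
  show ?thesis
    unfolding jacobi_coeff_mult[OF assms] e s using assms by (simp add: power_int_add)
qed

lemma jacobi_coeff_odd:
  assumes "p \<noteq> 0"
  shows "jacobi_coeff p (i + j + 1) * jacobi_coeff p (i - j) = - (p powi (i * i) * p powi (j * j + j))"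
proof -
  have "even ((i + j + 1) * (i + j + 1 - 1))" "even ((i - j) * (i - j - 1))" by auto
  moreover have "(i + j + 1) * (i + j + 1 - 1) + (i - j) * (i - j - 1) = 2 * (i * i + (j * j + j))"
    by (simp add: algebra_simps)
  ultimately have e: "(i + j + 1) * (i + j + 1 - 1) div 2 + (i - j) * (i - j - 1) div 2 = i * i + (j * j + j)"
    by (rule half_add_half)
  have s: "(-1 :: complex) powi (i + j + 1 + (i - j)) = -1"
    by (simp add: power_int_add)
  show ?thesis
    unfolding jacobi_coeff_mult[OF assms] e s using assms by (simp add: power_int_add)
qed

section \<open>The addition formula\<close>

definition theta_even :: "complex \<Rightarrow> complex \<Rightarrow> complex" where
  "theta_even p y = (\<Sum>\<^sub>\<infinity>j. p powi (j * j) * y powi (2 * j))"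

definition theta_odd :: "complex \<Rightarrow> complex \<Rightarrow> complex" where
  "theta_odd p y = (\<Sum>\<^sub>\<infinity>j. p powi (j * j + j) * y powi (2 * j + 1))"

lemma power_int_double:
  fixes z :: complex
  assumes "z \<noteq> 0"
  shows "z powi (2 * i) = z powi i * z powi i" "z powi (i * 2) = z powi i * z powi i"
proof -
  show "z powi (2 * i) = z powi i * z powi i"
    using power_int_add[of z i i] assms by simp
  thus "z powi (i * 2) = z powi i * z powi i" by (simp add: mult.commute)
qed

text \<open>
  The product is a double series with terms in \<open>a powi (m + n) * y powi (m - n)\<close>. The numbers \<open>m + n\<close>
  and \<open>m - n\<close> have the same parity; the even and the odd part each separate into a function of \<open>a\<close>
  times a function of \<open>y\<close>, and after division by \<open>a\<close> the same two functions occur in both parts.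
\<close>

lemma jacobi_product:
  assumes p: "p \<noteq> 0" and a: "a \<noteq> 0" and y: "y \<noteq> 0"
    and s: "\<And>x. x \<noteq> 0 \<Longrightarrow> (\<lambda>n. jacobi_coeff p n * x powi n) summable_on UNIV"
  shows "(\<Sum>\<^sub>\<infinity>n. jacobi_coeff p n * (a * y) powi n) * (\<Sum>\<^sub>\<infinity>n. jacobi_coeff p n * (a / y) powi n)
    = a * (theta_odd p a * theta_even p y - theta_even p a * theta_odd p y)"
proof -
  let ?f = "\<lambda>n. jacobi_coeff p n * (a * y) powi n" and ?g = "\<lambda>n. jacobi_coeff p n * (a / y) powi n"
  let ?e = "\<lambda>(i, j). (i + j, i - j) :: int \<times> int" and ?o = "\<lambda>(i, j). (i + j + 1, i - j) :: int \<times> int"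
  define H where "H = (\<lambda>(m, n). ?f m * ?g n)"
  have H: "H summable_on UNIV"
    unfolding H_def by (rule product_summable) (use s a y in \<open>auto simp: summable_on_iff_abs_summable_on_complex[symmetric]\<close>)
  have inj: "inj ?e" "inj ?o" by (auto simp: inj_on_def)
  have dis: "range ?e \<inter> range ?o = {}"
    by auto presburger
  have un: "range ?e \<union> range ?o = UNIV"
  proof -
    have "(m, n) \<in> range ?e \<union> range ?o" for m n :: int
    proof (cases "even (m + n)")
      case True
      then obtain i where "m + n = 2 * i" by blast
      hence "(m, n) = ?e (i, m - i)" by auto
      thus ?thesis by blast
    next
      case False
      then obtain i where "m + n = 2 * i + 1" by (metis oddE)
      hence "(m, n) = ?o (i, m - i - 1)" by auto
      thus ?thesis by blast
    qed
    thus ?thesis by auto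
  qed
  have He: "H (?e (i, j)) = (p powi (i * i - i) * a powi (2 * i)) * (p powi (j * j) * y powi (2 * j))" for i j
  proof -
    have "(a * y) powi (i + j) * (a / y) powi (i - j) = a powi (2 * i) * y powi (2 * j)"
      using a y by (simp add: power_int_mult_distrib power_int_divide_distrib power_int_add
          power_int_diff power_int_double field_simps)
    moreover have "H (?e (i, j)) = (jacobi_coeff p (i + j) * jacobi_coeff p (i - j))
        * ((a * y) powi (i + j) * (a / y) powi (i - j))" by (simp add: H_def)
    ultimately show ?thesis by (simp add: jacobi_coeff_even[OF p])
  qed
  have Ho: "H (?o (i, j)) = (p powi (i * i) * a powi (2 * i + 1)) * - (p powi (j * j + j) * y powi (2 * j + 1))" for i j
  proof -
    have "(a * y) powi (i + j + 1) * (a / y) powi (i - j) = a powi (2 * i + 1) * y powi (2 * j + 1)"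
      using a y by (simp add: power_int_mult_distrib power_int_divide_distrib power_int_add
          power_int_diff power_int_double field_simps)
    moreover have "H (?o (i, j)) = (jacobi_coeff p (i + j + 1) * jacobi_coeff p (i - j))
        * ((a * y) powi (i + j + 1) * (a / y) powi (i - j))" by (simp add: H_def)
    ultimately show ?thesis by (simp add: jacobi_coeff_odd[OF p])
  qed
  have se: "H summable_on range ?e" and so: "H summable_on range ?o"
    by (rule summable_on_subset_banach[OF H], simp)+
  have se': "(\<lambda>x. H (?e x)) summable_on UNIV" and so': "(\<lambda>x. H (?o x)) summable_on UNIV"
    using se so summable_on_reindex[OF inj(1), of H] summable_on_reindex[OF inj(2), of H]
    by (simp_all add: o_def)
  have b: "bij_betw (\<lambda>k::int. k + 1) UNIV UNIV"
    by (rule bij_betwI[where g = "\<lambda>k. k - 1"]) auto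
  have shift: "(\<Sum>\<^sub>\<infinity>i. p powi (i * i - i) * a powi (2 * i)) = a * theta_odd p a"
  proof -
    have "(\<Sum>\<^sub>\<infinity>i. p powi (i * i - i) * a powi (2 * i))
        = (\<Sum>\<^sub>\<infinity>i. p powi ((i + 1) * (i + 1) - (i + 1)) * a powi (2 * (i + 1)))"
      using infsum_reindex_bij_betw[OF b, of "\<lambda>i. p powi (i * i - i) * a powi (2 * i)"] by simp
    also have "\<dots> = (\<Sum>\<^sub>\<infinity>i. a * (p powi (i * i + i) * a powi (2 * i + 1)))"
      using a by (intro infsum_cong) (simp add: power_int_add algebra_simps power2_eq_square)
    finally show ?thesis by (simp add: infsum_cmult_right' theta_odd_def)
  qed
  have scale: "(\<Sum>\<^sub>\<infinity>i. p powi (i * i) * a powi (2 * i + 1)) = a * theta_even p a"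
    unfolding theta_even_def infsum_cmult_right'[symmetric]
    using a by (intro infsum_cong) (simp add: power_int_add)
  have "(\<Sum>\<^sub>\<infinity>n. ?f n) * (\<Sum>\<^sub>\<infinity>n. ?g n) = infsum H UNIV"
    using infsum_product[of ?f ?g] H by (simp add: H_def)
  also have "\<dots> = infsum H (range ?e) + infsum H (range ?o)"
    using infsum_Un_disjoint[OF se so dis] un by simp
  also have "infsum H (range ?e) = (\<Sum>\<^sub>\<infinity>x. H (?e x))"
    using infsum_reindex[OF inj(1), of H] by (simp add: o_def)
  also have "\<dots> = (\<Sum>\<^sub>\<infinity>i. p powi (i * i - i) * a powi (2 * i)) * theta_even p y"
    unfolding theta_even_def
    by (subst infsum_product[symmetric]) (use se' He in \<open>simp_all add: case_prod_unfold\<close>)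
  also have "infsum H (range ?o) = (\<Sum>\<^sub>\<infinity>x. H (?o x))"
    using infsum_reindex[OF inj(2), of H] by (simp add: o_def)
  also have "\<dots> = (\<Sum>\<^sub>\<infinity>i. p powi (i * i) * a powi (2 * i + 1)) * - theta_odd p y"
    unfolding theta_odd_def infsum_uminus[symmetric]
    by (subst infsum_product[symmetric]) (use so' Ho in \<open>simp_all add: case_prod_unfold\<close>)
  finally show ?thesis unfolding shift scale by (simp add: algebra_simps)
qed

text \<open>
  The theta pair that is to play the role of \<open>a - y\<close> in polynomial interpolation; the factor \<open>1 / a\<close>
  makes it antisymmetric.
\<close>

definition theta_bracket :: "complex \<Rightarrow> complex \<Rightarrow> complex \<Rightarrow> complex" where
  "theta_bracket p a y = mtheta (a * y) p * mtheta (a / y) p / a"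

lemma theta_bracket_zero:
  assumes "a \<noteq> 0" "y \<noteq> 0"
  shows "theta_bracket 0 a y = (a + 1 / a) - (y + 1 / y)"
proof -
  have q0: "qpoch_inf x 0 = 1 - x" for x
  proof -
    have "euler_series 0 x = 1 - x"
      using euler_series_step[of 0 x] by (simp add: euler_series_def powser_zero)
    thus ?thesis by (simp add: qpoch_inf_eq_euler_series)
  qed
  show ?thesis
    using assms by (simp add: theta_bracket_def mtheta_eq_qpoch q0 field_simps)
qed

text \<open>
  This is the addition formula in disguise: the bracket is a two by two determinant of values of two
  functions. Weierstrass' three-term relation is the Pluecker relation of such determinants.
\<close>

lemma theta_bracket_rank_two:
  assumes p: "norm p < 1"
  obtains X Y where "\<And>a y. a \<noteq> 0 \<Longrightarrow> y \<noteq> 0 \<Longrightarrow> theta_bracket p a y = Y a * X y - X a * Y y"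
proof (cases "p = 0 \<or> theta_coeff p 0 = 0")
  case True
  show ?thesis
  proof (cases "p = 0")
    case True
    have "theta_bracket p a y = (a + 1 / a) * 1 - 1 * (y + 1 / y)" if "a \<noteq> 0" "y \<noteq> 0" for a y
      using that True by (simp add: theta_bracket_zero)
    thus ?thesis by (rule that)
  next
    case False
    \<comment> \<open>This case does not occur, but it is covered at once: theta would vanish identically.\<close>
    have "theta_coeff p n = 0" for n
      using theta_coeff_closed[OF p False, of n] True False by simp
    hence "theta_bracket p a y = 0 * 0 - 0 * 0" if "a \<noteq> 0" "y \<noteq> 0" for a y
      using that p False by (simp add: theta_bracket_def mtheta_laurent(2))
    thus ?thesis by (rule that)
  qed
next
  case False
  hence p0: "p \<noteq> 0" and c: "theta_coeff p 0 \<noteq> 0" by auto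
  let ?c = "theta_coeff p 0"
  have cl: "theta_coeff p n * x powi n = ?c * (jacobi_coeff p n * x powi n)" for n x
    by (subst theta_coeff_closed[OF p p0]) simp
  have s: "(\<lambda>n. jacobi_coeff p n * x powi n) summable_on UNIV" if "x \<noteq> 0" for x
    using mtheta_laurent(1)[OF p p0 that] c unfolding cl
    by (simp add: summable_on_cmult_right')
  have th: "mtheta x p = ?c * (\<Sum>\<^sub>\<infinity>n. jacobi_coeff p n * x powi n)" if "x \<noteq> 0" for x
    using mtheta_laurent(2)[OF p p0 that] unfolding cl by (simp add: infsum_cmult_right')
  have "theta_bracket p a y = ?c * theta_odd p a * (?c * theta_even p y) - ?c * theta_even p a * (?c * theta_odd p y)"
    if "a \<noteq> 0" "y \<noteq> 0" for a y
  proof -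
    have "theta_bracket p a y = ?c ^ 2 * ((\<Sum>\<^sub>\<infinity>n. jacobi_coeff p n * (a * y) powi n)
        * (\<Sum>\<^sub>\<infinity>n. jacobi_coeff p n * (a / y) powi n)) / a"
      using that by (simp add: theta_bracket_def th power2_eq_square)
    also have "\<dots> = ?c ^ 2 * (theta_odd p a * theta_even p y - theta_even p a * theta_odd p y)"
      using jacobi_product[OF p0 that(1,2)] s that by simp
    finally show ?thesis by (simp add: power2_eq_square algebra_simps)
  qed
  thus ?thesis by (rule that)
qed

lemma theta_bracket_antisym:
  assumes p: "norm p < 1" and "a \<noteq> 0" "y \<noteq> 0"
  shows "theta_bracket p y a = - theta_bracket p a y"
proof -
  obtain X Y where E: "\<And>a y. a \<noteq> 0 \<Longrightarrow> y \<noteq> 0 \<Longrightarrow> theta_bracket p a y = Y a * X y - X a * Y y"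
    by (rule theta_bracket_rank_two[OF p]) blast
  show ?thesis using assms by (simp add: E)
qed

section \<open>Theta polynomials and interpolation\<close>

text \<open>
  The analogue of the polynomials of degree at most one. By the rank two representation, the relation
  says that \<open>u\<close> is a linear combination of the two functions there (when the bracket is not
  identically zero); in this form it lets a value of \<open>u\<close> be traded for its values at two given points.
\<close>

definition theta_linear :: "complex \<Rightarrow> (complex \<Rightarrow> complex) set" where
  "theta_linear p = {u. continuous_on (- {0}) u \<and>
     (\<forall>y z w. y \<noteq> 0 \<longrightarrow> z \<noteq> 0 \<longrightarrow> w \<noteq> 0 \<longrightarrow>
        u y * theta_bracket p z w + u z * theta_bracket p w y + u w * theta_bracket p y z = 0)}"

lemma theta_linearD:
  assumes "u \<in> theta_linear p" "y \<noteq> 0" "z \<noteq> 0" "w \<noteq> 0"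
  shows "u y * theta_bracket p z w + u z * theta_bracket p w y + u w * theta_bracket p y z = 0"
  using assms by (simp add: theta_linear_def)

lemma theta_linear_cmult:
  assumes "u \<in> theta_linear p" and v: "\<And>y. y \<noteq> 0 \<Longrightarrow> v y = c * u y"
  shows "v \<in> theta_linear p"
proof -
  have "continuous_on (- {0}) (\<lambda>y. c * u y)"
    using assms(1) by (intro continuous_intros) (simp add: theta_linear_def)
  hence "continuous_on (- {0}) v"
    by (rule continuous_on_cong[THEN iffD1, rotated -1]) (simp_all add: v)
  moreover have "v y * theta_bracket p z w + v z * theta_bracket p w y + v w * theta_bracket p y z = 0"
    if "y \<noteq> 0" "z \<noteq> 0" "w \<noteq> 0" for y z w
  proof -
    have "v y * theta_bracket p z w + v z * theta_bracket p w y + v w * theta_bracket p y z =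
      c * (u y * theta_bracket p z w + u z * theta_bracket p w y + u w * theta_bracket p y z)"
      using that by (simp add: v algebra_simps)
    thus ?thesis using theta_linearD[OF assms(1) that] by simp
  qed
  ultimately show ?thesis by (simp add: theta_linear_def)
qed

lemma theta_bracket_linear:
  assumes p: "norm p < 1" and a: "a \<noteq> 0"
  shows "theta_bracket p a \<in> theta_linear p"
proof -
  obtain X Y where E: "\<And>a y. a \<noteq> 0 \<Longrightarrow> y \<noteq> 0 \<Longrightarrow> theta_bracket p a y = Y a * X y - X a * Y y"
    by (rule theta_bracket_rank_two[OF p]) blast
  have "isCont (theta_bracket p a) y" if "y \<noteq> 0" for y
    unfolding theta_bracket_def[abs_def]
    by (intro continuous_intros isCont_o2[OF _ continuous_mtheta[OF p]]) (use a that in auto)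
  hence "continuous_on (- {0}) (theta_bracket p a)"
    by (simp add: continuous_at_imp_continuous_on)
  thus ?thesis
    using a by (simp add: theta_linear_def E algebra_simps)
qed

text \<open>
  Sums of products of \<open>n\<close> functions from \<open>theta_linear\<close>, the analogue of the polynomials of degree at
  most \<open>n\<close>. As a generation scheme, it provides the induction by which the partial fraction identity
  is proved.
\<close>

inductive theta_poly :: "complex \<Rightarrow> nat \<Rightarrow> (complex \<Rightarrow> complex) \<Rightarrow> bool" for p where
  const: "theta_poly p 0 (\<lambda>_. c)"
| linear_mult: "u \<in> theta_linear p \<Longrightarrow> theta_poly p n h \<Longrightarrow> theta_poly p (Suc n) (\<lambda>y. u y * h y)"
| add: "theta_poly p n g \<Longrightarrow> theta_poly p n h \<Longrightarrow> theta_poly p n (\<lambda>y. g y + h y)"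

lemma theta_poly_isCont:
  assumes "theta_poly p n h" "y \<noteq> 0"
  shows "isCont h y"
  using assms
proof (induction rule: theta_poly.induct)
  case (linear_mult u n h)
  have "isCont u y" using linear_mult(1) \<open>y \<noteq> 0\<close>
    by (auto simp: theta_linear_def continuous_on_eq_continuous_at open_Compl)
  thus ?case using linear_mult by (intro continuous_intros) auto
qed (auto intro!: continuous_intros)

lemma theta_poly_cmult:
  assumes "theta_poly p n h"
  shows "theta_poly p n (\<lambda>y. c * h y)"
  using assms
proof (induction rule: theta_poly.induct)
  case (const d)
  show ?case by (rule theta_poly.const)
next
  case (linear_mult u n h)
  thus ?case using theta_poly.linear_mult[of u p n "\<lambda>y. c * h y"] by (simp add: mult_ac)
next
  case (add n g h)
  thus ?case using theta_poly.add[of p n "\<lambda>y. c * g y" "\<lambda>y. c * h y"] by (simp add: distrib_left)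
qed

lemma theta_poly_mult:
  assumes "theta_poly p m g" "theta_poly p n h"
  shows "theta_poly p (m + n) (\<lambda>y. g y * h y)"
  using assms
proof (induction rule: theta_poly.induct)
  case (const c)
  thus ?case using theta_poly_cmult[of p n h c] by simp
next
  case (linear_mult u m g)
  thus ?case using theta_poly.linear_mult[of u p "m + n" "\<lambda>y. g y * h y"] by (simp add: mult_ac)
next
  case (add m f g)
  thus ?case using theta_poly.add[of p "m + n" "\<lambda>y. f y * h y" "\<lambda>y. g y * h y"]
    by (simp add: distrib_right)
qed

lemma theta_poly_power:
  assumes "u \<in> theta_linear p"
  shows "theta_poly p n (\<lambda>y. u y ^ n)"
proof (induction n)
  case 0 thus ?case using theta_poly.const[of p 1] by simp
next
  case (Suc n) thus ?case using theta_poly.linear_mult[OF assms Suc] by simp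
qed

lemma theta_poly_sum:
  assumes "\<And>k. theta_poly p n (g k)"
  shows "theta_poly p n (\<lambda>y. \<Sum>k\<le>(m::nat). g k y)"
proof (induction m)
  case (Suc m) thus ?case using theta_poly.add[OF Suc assms] by simp
qed (simp add: assms)

lemma theta_poly_prod:
  assumes "\<And>i. i \<in> {1..m} \<Longrightarrow> theta_poly p (N i) (g i)"
  shows "theta_poly p (\<Sum>i=1..m. N i) (\<lambda>y. \<Prod>i=1..m::nat. g i y)"
  using assms
proof (induction m)
  case 0 thus ?case using theta_poly.const[of p 1] by simp
next
  case (Suc m)
  thus ?case using theta_poly_mult[of p "\<Sum>i=1..m. N i" "\<lambda>y. \<Prod>i=1..m. g i y" "N (Suc m)" "g (Suc m)"]
    by simp
qed

text \<open>
  For ordinary polynomials this says that the divided difference of order \<open>n + 1\<close> annihilates degree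
  \<open>n\<close>. In the induction step a linear factor \<open>u\<close> is written in terms of the brackets with two of the
  nodes, \<open>y a\<close> and \<open>y b\<close>. The bracket with a node removes this node from the sum and cancels
  against the denominators of all others, so that both resulting sums are instances of the
  induction hypothesis with one node fewer.
\<close>

lemma theta_partial_fractions:
  fixes y :: "'i \<Rightarrow> complex"
  assumes p: "norm p < 1" and h: "theta_poly p n h"
    and "finite I" "card I = n + 2" "\<And>i. i \<in> I \<Longrightarrow> y i \<noteq> 0"
    and "\<And>i j. i \<in> I \<Longrightarrow> j \<in> I \<Longrightarrow> i \<noteq> j \<Longrightarrow> theta_bracket p (y i) (y j) \<noteq> 0"
  shows "(\<Sum>i\<in>I. h (y i) / (\<Prod>j\<in>I-{i}. theta_bracket p (y j) (y i))) = 0"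
  using h assms(3-)
proof (induction arbitrary: I rule: theta_poly.induct)
  case (const c)
  hence "card I = 2" by simp
  then obtain a b where I: "I = {a, b}" "a \<noteq> b" by (metis card_2_iff)
  have "{a, b} - {a} = {b}" "{a, b} - {b} = {a}" using I by auto
  thus ?case using I const theta_bracket_antisym[OF p, of "y a" "y b"] by simp
next
  case (add n g h)
  thus ?case by (simp add: add_divide_distrib sum.distrib)
next
  case (linear_mult u n h)
  let ?E = "\<lambda>i j. theta_bracket p (y i) (y j)"
  let ?D = "\<lambda>i. \<Prod>j\<in>I-{i}. ?E j i"
  note fin = \<open>finite I\<close> and nz = linear_mult.prems(3) and Enz = linear_mult.prems(4)
  have drop: "(\<Sum>i\<in>I. h (y i) * ?E a i / ?D i) = 0" if a: "a \<in> I" for a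
  proof -
    have "?E a a = 0" using theta_bracket_antisym[OF p nz[OF a] nz[OF a]] by simp
    hence "(\<Sum>i\<in>I. h (y i) * ?E a i / ?D i) = (\<Sum>i\<in>I-{a}. h (y i) * ?E a i / ?D i)"
      using fin a by (subst sum.remove[of I a]) auto
    also have "\<dots> = (\<Sum>i\<in>I-{a}. h (y i) / (\<Prod>j\<in>I-{a}-{i}. ?E j i))"
    proof (rule sum.cong)
      fix i assume i: "i \<in> I - {a}"
      have "?D i = ?E a i * (\<Prod>j\<in>I-{i}-{a}. ?E j i)"
        using fin a i by (intro prod.remove) auto
      moreover have "I - {i} - {a} = I - {a} - {i}" by auto
      ultimately show "h (y i) * ?E a i / ?D i = h (y i) / (\<Prod>j\<in>I-{a}-{i}. ?E j i)"
        using Enz[of a i] i a by auto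
    qed simp
    also have "\<dots> = 0"
      using linear_mult.prems a by (intro linear_mult.IH) auto
    finally show ?thesis .
  qed
  obtain a where a: "a \<in> I" using linear_mult.prems(2) by fastforce
  have "I - {a} \<noteq> {}" using linear_mult.prems(2) a fin by (metis card_Diff_singleton card.empty
      add_2_eq_Suc' diff_Suc_1 nat.distinct(1))
  then obtain b where b: "b \<in> I" "b \<noteq> a" by blast
  have split: "u (y i) * ?E a b = ?E a i * u (y b) - ?E b i * u (y a)" if "i \<in> I" for i
    using theta_linearD[OF linear_mult.hyps(1) nz[OF that] nz[OF a] nz[OF b(1)]]
      theta_bracket_antisym[OF p nz[OF a] nz[OF that]]
    by (simp add: algebra_simps add_eq_0_iff)
  have "?E a b * (\<Sum>i\<in>I. u (y i) * h (y i) / ?D i)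
      = (\<Sum>i\<in>I. (u (y i) * ?E a b) * h (y i) / ?D i)"
    by (simp add: sum_distrib_left mult_ac)
  also have "\<dots> = (\<Sum>i\<in>I. u (y b) * (h (y i) * ?E a i / ?D i) - u (y a) * (h (y i) * ?E b i / ?D i))"
    by (rule sum.cong) (simp_all add: split diff_divide_distrib algebra_simps)
  also have "\<dots> = u (y b) * (\<Sum>i\<in>I. h (y i) * ?E a i / ?D i) - u (y a) * (\<Sum>i\<in>I. h (y i) * ?E b i / ?D i)"
    by (simp add: sum_subtractf sum_distrib_left)
  also have "\<dots> = 0" by (simp add: drop a b)
  finally show ?case using Enz[OF a b(1)] b(2) by auto
qed

text \<open>
  The partial fraction identity for the nodes together with \<open>x\<close> as one further node, solved for the
  term that belongs to \<open>x\<close>.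
\<close>

lemma theta_lagrange_interpolation:
  fixes y :: "nat \<Rightarrow> complex"
  assumes p: "norm p < 1" and h: "theta_poly p n h"
    and y: "\<And>i. i \<le> n \<Longrightarrow> y i \<noteq> 0" and x: "x \<noteq> 0"
    and E: "\<And>i j. i \<le> n \<Longrightarrow> j \<le> n \<Longrightarrow> i \<noteq> j \<Longrightarrow> theta_bracket p (y i) (y j) \<noteq> 0"
    and Ex: "\<And>i. i \<le> n \<Longrightarrow> theta_bracket p (y i) x \<noteq> 0"
  shows "h x = (\<Sum>k\<le>n. h (y k) * (\<Prod>j\<in>{..n}-{k}. theta_bracket p (y j) x / theta_bracket p (y j) (y k)))"
proof -
  define z where "z = y(Suc n := x)"
  let ?I = "{..Suc n}"
  let ?D = "\<lambda>k. \<Prod>j\<in>{..n}-{k}. theta_bracket p (y j) (y k)"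
  let ?F = "\<Prod>j\<le>n. theta_bracket p (y j) x"
  have zy: "z i = y i" if "i \<le> n" for i using that by (simp add: z_def)
  have zx: "z (Suc n) = x" by (simp add: z_def)
  have anti: "theta_bracket p x (y i) = - theta_bracket p (y i) x" if "i \<le> n" for i
    using theta_bracket_antisym[OF p y[OF that] x] .
  have F: "?F \<noteq> 0" using Ex by simp
  have zE: "theta_bracket p (z i) (z j) \<noteq> 0" if "i \<in> ?I" "j \<in> ?I" "i \<noteq> j" for i j
    using that E[of i j] Ex anti by (auto simp: le_Suc_eq zy zx)
  have "(\<Sum>i\<in>?I. h (z i) / (\<Prod>j\<in>?I-{i}. theta_bracket p (z j) (z i))) = 0"
    by (rule theta_partial_fractions[OF p h]) (use y x zE in \<open>auto simp: le_Suc_eq zy zx\<close>)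
  hence "(\<Sum>k\<le>n. h (z k) / (\<Prod>j\<in>?I-{k}. theta_bracket p (z j) (z k)))
      + h x / (\<Prod>j\<in>?I-{Suc n}. theta_bracket p (z j) x) = 0"
    by (simp add: zx)
  also have "?I - {Suc n} = {..n}" by auto
  also have "(\<Prod>j\<in>{..n}. theta_bracket p (z j) x) = ?F" by (simp add: zy)
  also have "(\<Sum>k\<le>n. h (z k) / (\<Prod>j\<in>?I-{k}. theta_bracket p (z j) (z k)))
      = (\<Sum>k\<le>n. - (h (y k) * (\<Prod>j\<in>{..n}-{k}. theta_bracket p (y j) x / theta_bracket p (y j) (y k)) / ?F))"
  proof (rule sum.cong)
    fix k assume "k \<in> {..n}"
    hence k: "k \<le> n" by simp
    have "?I - {k} = insert (Suc n) ({..n} - {k})" using k by auto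
    hence "(\<Prod>j\<in>?I-{k}. theta_bracket p (z j) (z k)) = theta_bracket p x (y k) * ?D k"
      using k by (simp add: zx zy)
    moreover have "?F = theta_bracket p (y k) x * (\<Prod>j\<in>{..n}-{k}. theta_bracket p (y j) x)"
      using k by (intro prod.remove) auto
    moreover have "(\<Prod>j\<in>{..n}-{k}. theta_bracket p (y j) x) \<noteq> 0" using Ex by simp
    ultimately show "h (z k) / (\<Prod>j\<in>?I-{k}. theta_bracket p (z j) (z k))
      = - (h (y k) * (\<Prod>j\<in>{..n}-{k}. theta_bracket p (y j) x / theta_bracket p (y j) (y k)) / ?F)"
      using k Ex[OF k] by (simp add: prod_dividef anti zy)
  qed simp
  finally have "h x / ?F = (\<Sum>k\<le>n. h (y k) * (\<Prod>j\<in>{..n}-{k}. theta_bracket p (y j) x / theta_bracket p (y j) (y k))) / ?F"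
    by (simp add: sum_negf sum_divide_distrib)
  thus ?thesis using F by simp
qed

section \<open>Lagrange weights at the nodes of a geometric progression\<close>

lemma theta_fact_0 [simp]: "theta_fact x q p 0 = 1"
  by (simp add: theta_fact_def)

lemma theta_fact_Suc: "theta_fact x q p (Suc n) = theta_fact x q p n * mtheta (x * q ^ n) p"
  by (simp add: theta_fact_def)

lemma theta_fact_add:
  "theta_fact x q p (m + n) = theta_fact x q p m * theta_fact (x * q ^ m) q p n"
  by (induction n) (simp_all add: theta_fact_Suc power_add mult_ac)

lemma theta_fact_nonzero:
  "theta_fact x q p n \<noteq> 0 \<longleftrightarrow> (\<forall>k<n. mtheta (x * q ^ k) p \<noteq> 0)"
  by (auto simp: theta_fact_def)

text \<open>
  Here \<open>w\<close> and \<open>z\<close> are such that reading the arguments \<open>w, w * q, \<dots>\<close> backwards gives the inverses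
  of \<open>z, z * q, \<dots>\<close>.
\<close>

lemma theta_fact_reflect:
  assumes p: "norm p < 1" and q: "q \<noteq> 0" and z: "z \<noteq> 0" and w: "w * z * q ^ n = q"
  shows "theta_fact w q p n = (\<Prod>i<n. - (1 / (z * q ^ i))) * theta_fact z q p n"
proof -
  have "theta_fact w q p n = (\<Prod>i<n. mtheta (w * q ^ (n - Suc i)) p)"
    unfolding theta_fact_def by (rule prod.nat_diff_reindex[symmetric])
  also have "\<dots> = (\<Prod>i<n. - (1 / (z * q ^ i)) * mtheta (z * q ^ i) p)"
  proof (rule prod.cong)
    fix i assume "i \<in> {..<n}"
    hence "n = (n - Suc i) + i + 1" by auto
    hence "q ^ n = q ^ (n - Suc i) * q ^ i * q"
      by (metis power_add power_one_right)
    hence "(w * q ^ (n - Suc i)) * (z * q ^ i) * q = 1 * q" using w by (simp add: mult_ac)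
    hence "(w * q ^ (n - Suc i)) * (z * q ^ i) = 1" using q by simp
    hence "w * q ^ (n - Suc i) = 1 / (z * q ^ i)" using q z by (simp add: eq_divide_eq)
    thus "mtheta (w * q ^ (n - Suc i)) p = - (1 / (z * q ^ i)) * mtheta (z * q ^ i) p"
      using mtheta_inverse[OF p, of "z * q ^ i"] q z by simp
  qed simp
  finally show ?thesis by (simp only: prod.distrib theta_fact_def)
qed

text \<open>
  The next three lemmas evaluate the products over \<open>j \<noteq> k\<close> in the Lagrange weights: this one the
  numerators, which contain \<open>x\<close>; the other two the quotients and the products of two nodes
  \<open>C * q ^ j\<close> and \<open>C * q ^ k\<close>.
\<close>

lemma prod_theta_except:
  assumes k: "k \<le> n" and nz: "mtheta (z * q ^ k) p \<noteq> 0" "theta_fact (z * q) q p k \<noteq> 0"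
  shows "(\<Prod>j\<in>{..n}-{k}. mtheta (z * q ^ j) p)
     = theta_fact (z * q) q p n * theta_fact z q p k / theta_fact (z * q) q p k"
proof -
  let ?R = "\<Prod>j\<in>{..n}-{k}. mtheta (z * q ^ j) p"
  have h: "theta_fact z q p (Suc l) = mtheta z p * theta_fact (z * q) q p l" for l
    using theta_fact_add[of z q p 1 l] by (simp add: theta_fact_def)
  have "mtheta (z * q ^ k) p * ?R = theta_fact z q p (Suc n)"
    unfolding theta_fact_def lessThan_Suc_atMost
    using k by (intro prod.remove[symmetric]) auto
  hence "mtheta (z * q ^ k) p * ?R * theta_fact (z * q) q p k
     = mtheta z p * theta_fact (z * q) q p k * theta_fact (z * q) q p n"
    by (simp add: h)
  also have "mtheta z p * theta_fact (z * q) q p k = theta_fact z q p k * mtheta (z * q ^ k) p"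
    by (simp add: h[symmetric] theta_fact_Suc)
  finally show ?thesis using nz by (simp add: field_simps)
qed

lemma prod_theta_quotients:
  assumes p: "norm p < 1" and q: "q \<noteq> 0" and k: "k \<le> n"
  shows "q ^ (k * (n + 1)) * theta_fact (q powi (- int n)) q p k * (\<Prod>j\<in>{..n}-{k}. mtheta (q ^ j / q ^ k) p)
    = theta_fact q q p n * theta_fact q q p k"
proof -
  have split: "{..n} - {k} = {..<k} \<union> {k<..n}" using k by auto
  have "(\<Prod>j\<in>{..n}-{k}. mtheta (q ^ j / q ^ k) p)
      = (\<Prod>j<k. mtheta (q ^ j / q ^ k) p) * (\<Prod>j\<in>{k<..n}. mtheta (q ^ j / q ^ k) p)"
    unfolding split by (rule prod.union_disjoint) auto
  also have "(\<Prod>j<k. mtheta (q ^ j / q ^ k) p) = theta_fact (1 / q ^ k) q p k"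
    by (simp add: theta_fact_def)
  also have "\<dots> = (\<Prod>i<k. - (1 / (q * q ^ i))) * theta_fact q q p k"
    by (rule theta_fact_reflect[OF p q q]) (use q in simp)
  also have "(\<Prod>j\<in>{k<..n}. mtheta (q ^ j / q ^ k) p) = theta_fact q q p (n - k)"
    unfolding theta_fact_def
  proof (rule prod.reindex_bij_witness[of _ "\<lambda>i. i + Suc k" "\<lambda>j. j - Suc k"])
    fix j assume "j \<in> {k<..n}"
    hence "q ^ j = q ^ k * q ^ Suc (j - Suc k)" by (subst power_add[symmetric]) simp
    thus "mtheta (q * q ^ (j - Suc k)) p = mtheta (q ^ j / q ^ k) p" using q by simp
  qed auto
  finally have 1: "(\<Prod>j\<in>{..n}-{k}. mtheta (q ^ j / q ^ k) p)
    = (\<Prod>i<k. - (1 / (q * q ^ i))) * theta_fact q q p k * theta_fact q q p (n - k)" .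
  have 2: "theta_fact (q powi (- int n)) q p k
      = (\<Prod>i<k. - (1 / (q * q ^ (n - k) * q ^ i))) * theta_fact (q * q ^ (n - k)) q p k"
  proof (rule theta_fact_reflect[OF p q])
    have "q ^ n = q ^ (n - k) * q ^ k" using k by (simp flip: power_add)
    thus "q powi (- int n) * (q * q ^ (n - k)) * q ^ k = q"
      using q by (simp add: power_int_minus field_simps)
  qed (use q in simp)
  have 3: "theta_fact q q p n = theta_fact q q p (n - k) * theta_fact (q * q ^ (n - k)) q p k"
    using theta_fact_add[of q q p "n - k" k] k by simp
  \<comment> \<open>Reversing one of the two products of prefactors makes the powers of \<open>q\<close> cancel factor by factor.\<close>
  have 4: "q ^ (k * (n + 1)) * (\<Prod>i<k. - (1 / (q * q ^ (n - k) * q ^ i))) * (\<Prod>i<k. - (1 / (q * q ^ i))) = 1"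
  proof -
    have "(\<Prod>i<k. - (1 / (q * q ^ i))) = (\<Prod>i<k. - (1 / (q * q ^ (k - Suc i))))"
      by (rule prod.nat_diff_reindex[symmetric])
    hence "q ^ (k * (n + 1)) * (\<Prod>i<k. - (1 / (q * q ^ (n - k) * q ^ i))) * (\<Prod>i<k. - (1 / (q * q ^ i)))
       = (\<Prod>i<k. q ^ (n + 1) * (- (1 / (q * q ^ (n - k) * q ^ i))) * (- (1 / (q * q ^ (k - Suc i)))))"
      by (simp only: prod.distrib prod_constant card_lessThan power_mult[symmetric] mult.commute[of k])
    also have "\<dots> = (\<Prod>i<k. 1)"
    proof (rule prod.cong)
      fix i assume "i \<in> {..<k}"
      hence "n + 1 = Suc (n - k + i + Suc (k - Suc i))" using k by auto
      hence "q ^ (n + 1) = q * q ^ (n - k) * q ^ i * (q * q ^ (k - Suc i))"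
        by (simp only: power_Suc power_add mult_ac)
      thus "q ^ (n + 1) * (- (1 / (q * q ^ (n - k) * q ^ i))) * (- (1 / (q * q ^ (k - Suc i)))) = 1"
        using q by simp
    qed simp
    finally show ?thesis by simp
  qed
  have "q ^ (k * (n + 1)) * theta_fact (q powi (- int n)) q p k * (\<Prod>j\<in>{..n}-{k}. mtheta (q ^ j / q ^ k) p)
    = (q ^ (k * (n + 1)) * (\<Prod>i<k. - (1 / (q * q ^ (n - k) * q ^ i))) * (\<Prod>i<k. - (1 / (q * q ^ i))))
       * (theta_fact q q p (n - k) * theta_fact (q * q ^ (n - k)) q p k) * theta_fact q q p k"
    unfolding 1 2 by (simp only: mult_ac)
  thus ?thesis unfolding 4 3[symmetric] by simp
qed

lemma prod_theta_sums:
  assumes k: "k \<le> n"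
    and nz: "\<And>j. j \<le> 2 * n \<Longrightarrow> mtheta (c * q ^ j) p \<noteq> 0"
  shows "(\<Prod>j\<in>{..n}-{k}. mtheta (c * q ^ (j + k)) p)
    = mtheta c p * theta_fact (c * q) q p n * theta_fact (c * q ^ (n + 1)) q p k
       / (theta_fact c q p k * mtheta (c * q ^ (2 * k)) p)"
proof -
  let ?R = "\<Prod>j\<in>{..n}-{k}. mtheta (c * q ^ (j + k)) p"
  have "mtheta (c * q ^ (k + k)) p * ?R = (\<Prod>j\<le>n. mtheta (c * q ^ (j + k)) p)"
    using k by (intro prod.remove[symmetric]) auto
  also have "\<dots> = theta_fact (c * q ^ k) q p (Suc n)"
    by (simp add: theta_fact_def lessThan_Suc_atMost power_add mult_ac)
  finally have "theta_fact c q p k * (mtheta (c * q ^ (k + k)) p * ?R) = theta_fact c q p (k + Suc n)"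
    by (simp only: theta_fact_add)
  also have "\<dots> = theta_fact c q p (1 + n + k)" by (simp add: add.commute)
  also have "\<dots> = mtheta c p * theta_fact (c * q) q p n * theta_fact (c * q ^ (n + 1)) q p k"
    unfolding theta_fact_add[of c q p "1 + n"] theta_fact_add[of c q p 1]
    by (simp add: theta_fact_def)
  finally have "?R * (theta_fact c q p k * mtheta (c * q ^ (2 * k)) p)
    = mtheta c p * theta_fact (c * q) q p n * theta_fact (c * q ^ (n + 1)) q p k"
    unfolding mult_2 by (simp only: mult_ac)
  moreover have "theta_fact c q p k \<noteq> 0" "mtheta (c * q ^ (2 * k)) p \<noteq> 0"
    using nz k by (auto simp: theta_fact_nonzero)
  ultimately show ?thesis by (simp add: eq_divide_eq)
qed

text \<open>
  The very-well-poised part of the summand; the powers of \<open>q\<close> are kept apart.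
\<close>

definition well_poised_weight :: "complex \<Rightarrow> complex \<Rightarrow> complex \<Rightarrow> complex \<Rightarrow> nat \<Rightarrow> nat \<Rightarrow> complex" where
  "well_poised_weight p q C x n k =
     mtheta (C ^ 2 * q ^ (2 * k)) p / mtheta (C ^ 2) p
     * (theta_facts [C ^ 2, C / x, C * x, q powi (- int n)] q p k
        / theta_facts [q, C * x * q, C * q / x, C ^ 2 * q ^ (n + 1)] q p k)"

lemma theta_facts_Cons [simp]: "theta_facts (x # xs) q p n = theta_fact x q p n * theta_facts xs q p n"
  and theta_facts_Nil [simp]: "theta_facts [] q p n = 1"
  by (simp_all add: theta_facts_def)

text \<open>
  The summand of the very-well-poised series is a Lagrange weight, up to a factor independent of
  \<open>k\<close>.
\<close>

lemma lagrange_weight: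
  assumes p: "norm p < 1" and q: "q \<noteq> 0" and C: "C \<noteq> 0" and x: "x \<noteq> 0" and k: "k \<le> n"
    and qn: "theta_fact q q p n \<noteq> 0"
    and C2: "\<And>j. j \<le> 2 * n \<Longrightarrow> mtheta (C ^ 2 * q ^ j) p \<noteq> 0"
    and Cx: "\<And>j. j \<le> n \<Longrightarrow> mtheta (C * x * q ^ j) p \<noteq> 0"
    and C_x: "\<And>j. j \<le> n \<Longrightarrow> mtheta (C / x * q ^ j) p \<noteq> 0"
  shows "theta_facts [q, C ^ 2 * q] q p n / theta_facts [C * x * q, C * q / x] q p n
     * (\<Prod>j\<in>{..n}-{k}. theta_bracket p (C * q ^ j) x / theta_bracket p (C * q ^ j) (C * q ^ k))
    = q ^ (k * (n + 1)) * well_poised_weight p q C x n k"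
proof -
  let ?T = "\<lambda>z. theta_fact z q p"
  have nz: "?T (z * q) l \<noteq> 0" if "\<And>j. j \<le> n \<Longrightarrow> mtheta (z * q ^ j) p \<noteq> 0" "l \<le> n" for z l
    using that by (auto simp: theta_fact_nonzero mult.assoc simp flip: power_Suc)
  have nzx: "?T (C * x * q) n \<noteq> 0" "?T (C / x * q) n \<noteq> 0" "?T (C * x * q) k \<noteq> 0" "?T (C / x * q) k \<noteq> 0"
    using nz[of "C * x"] nz[of "C / x"] Cx C_x k by auto
  have qk: "?T q k \<noteq> 0" using qn k by (auto simp: theta_fact_nonzero)
  have q4: "q ^ (k * (n + 1)) * ?T (q powi (- int n)) k * (\<Prod>j\<in>{..n}-{k}. mtheta (q ^ j / q ^ k) p)
    = ?T q n * ?T q k" by (rule prod_theta_quotients[OF p q k])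
  hence q4nz: "?T (q powi (- int n)) k \<noteq> 0" "(\<Prod>j\<in>{..n}-{k}. mtheta (q ^ j / q ^ k) p) \<noteq> 0"
    using qn qk by (metis mult_eq_0_iff)+
  have C2nz: "mtheta (C ^ 2) p \<noteq> 0" "?T (C ^ 2) k \<noteq> 0" "mtheta (C ^ 2 * q ^ (2 * k)) p \<noteq> 0"
      "?T (C ^ 2 * q) n \<noteq> 0" 
    using C2[of 0] C2 k nz[of "C ^ 2" n] by (auto simp: theta_fact_nonzero)
  have C2nz': "?T (C ^ 2 * q ^ (n + 1)) k \<noteq> 0"
    using C2 k by (auto simp: theta_fact_nonzero mult.assoc simp del: power_Suc simp flip: power_add power_Suc)
  have "(\<Prod>j\<in>{..n}-{k}. theta_bracket p (C * q ^ j) x / theta_bracket p (C * q ^ j) (C * q ^ k))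
     = (\<Prod>j\<in>{..n}-{k}. mtheta (C * x * q ^ j) p * mtheta (C / x * q ^ j) p
         / (mtheta (C ^ 2 * q ^ (j + k)) p * mtheta (q ^ j / q ^ k) p))"
    using C q by (intro prod.cong) (simp_all add: theta_bracket_def mult_ac power2_eq_square power_add)
  also have "\<dots> = (\<Prod>j\<in>{..n}-{k}. mtheta (C * x * q ^ j) p) * (\<Prod>j\<in>{..n}-{k}. mtheta (C / x * q ^ j) p)
         / ((\<Prod>j\<in>{..n}-{k}. mtheta (C ^ 2 * q ^ (j + k)) p) * (\<Prod>j\<in>{..n}-{k}. mtheta (q ^ j / q ^ k) p))"
    by (simp only: prod.distrib prod_dividef)
  also have "(\<Prod>j\<in>{..n}-{k}. mtheta (q ^ j / q ^ k) p) = ?T q n * ?T q k / (q ^ (k * (n + 1)) * ?T (q powi (- int n)) k)"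
    using q4 q4nz q by (simp add: field_simps)
  also have "(\<Prod>j\<in>{..n}-{k}. mtheta (C ^ 2 * q ^ (j + k)) p)
    = mtheta (C ^ 2) p * ?T (C ^ 2 * q) n * ?T (C ^ 2 * q ^ (n + 1)) k
       / (?T (C ^ 2) k * mtheta (C ^ 2 * q ^ (2 * k)) p)"
    using prod_theta_sums[OF k C2] by simp
  also have "(\<Prod>j\<in>{..n}-{k}. mtheta (C * x * q ^ j) p) = ?T (C * x * q) n * ?T (C * x) k / ?T (C * x * q) k"
    by (rule prod_theta_except[OF k Cx[OF k] nzx(3)])
  also have "(\<Prod>j\<in>{..n}-{k}. mtheta (C / x * q ^ j) p) = ?T (C / x * q) n * ?T (C / x) k / ?T (C / x * q) k"
    by (rule prod_theta_except[OF k C_x[OF k] nzx(4)])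
  finally show ?thesis
    using nzx qk qn q4nz(1) C2nz C2nz' q
    by (simp add: well_poised_weight_def mult_ac)
qed

text \<open>
  Lagrange interpolation at the nodes \<open>C * q ^ k\<close>. Nodes of which two coincide, or one coincides
  with \<open>x\<close>, in the sense of a vanishing bracket, are excluded here by the conditions on \<open>C\<close>.
\<close>

lemma elliptic_sum_generic:
  assumes p: "norm p < 1" and q: "q \<noteq> 0" and C: "C \<noteq> 0" and x: "x \<noteq> 0"
    and h: "theta_poly p n h"
    and qn: "theta_fact q q p n \<noteq> 0"
    and C2: "\<And>j. j \<le> 2 * n \<Longrightarrow> mtheta (C ^ 2 * q ^ j) p \<noteq> 0"
    and Cx: "\<And>j. j \<le> n \<Longrightarrow> mtheta (C * x * q ^ j) p \<noteq> 0"
    and C_x: "\<And>j. j \<le> n \<Longrightarrow> mtheta (C / x * q ^ j) p \<noteq> 0"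
  shows "theta_facts [q, C ^ 2 * q] q p n / theta_facts [C * x * q, C * q / x] q p n * h x
    = (\<Sum>k\<le>n. q ^ (k * (n + 1)) * well_poised_weight p q C x n k * h (C * q ^ k))"
proof -
  have qpow: "mtheta (q ^ Suc j) p \<noteq> 0" if "j < n" for j
    using qn that by (simp add: theta_fact_nonzero)
  have qd: "mtheta (q ^ i / q ^ j) p \<noteq> 0" if ij: "i \<le> n" "j \<le> n" "i \<noteq> j" for i j
  proof (cases "j < i")
    case True
    hence "q ^ i = q ^ j * q ^ Suc (i - j - 1)" by (subst power_add[symmetric]) simp
    hence "q ^ i / q ^ j = q ^ Suc (i - j - 1)" using q by simp
    thus ?thesis using qpow[of "i - j - 1"] True ij by simp
  next
    case False
    hence "q ^ j = q ^ i * q ^ Suc (j - i - 1)" using ij by (subst power_add[symmetric]) simp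
    hence "q ^ i / q ^ j = 1 / q ^ Suc (j - i - 1)" using q by simp
    moreover have "mtheta (q ^ Suc (j - i - 1)) p \<noteq> 0" using False ij by (intro qpow) auto
    ultimately show ?thesis using mtheta_inverse[OF p, of "q ^ Suc (j - i - 1)"] q by simp
  qed
  have "h x = (\<Sum>k\<le>n. h (C * q ^ k) *
      (\<Prod>j\<in>{..n}-{k}. theta_bracket p (C * q ^ j) x / theta_bracket p (C * q ^ j) (C * q ^ k)))"
  proof (rule theta_lagrange_interpolation[OF p h _ x])
    fix i j :: nat assume ij: "i \<le> n" "j \<le> n" "i \<noteq> j"
    have "mtheta (C ^ 2 * q ^ (i + j)) p \<noteq> 0" using ij by (intro C2) auto
    thus "theta_bracket p (C * q ^ i) (C * q ^ j) \<noteq> 0"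
      using qd[OF ij] C q by (simp add: theta_bracket_def power2_eq_square power_add mult_ac)
  next
    fix i assume i: "i \<le> n"
    show "theta_bracket p (C * q ^ i) x \<noteq> 0"
      using Cx[OF i] C_x[OF i] C q by (simp add: theta_bracket_def mult_ac)
  qed (use C q in auto)
  hence "theta_facts [q, C ^ 2 * q] q p n / theta_facts [C * x * q, C * q / x] q p n * h x
    = (\<Sum>k\<le>n. (theta_facts [q, C ^ 2 * q] q p n / theta_facts [C * x * q, C * q / x] q p n *
      (\<Prod>j\<in>{..n}-{k}. theta_bracket p (C * q ^ j) x / theta_bracket p (C * q ^ j) (C * q ^ k))) * h (C * q ^ k))"
    by (simp only: sum_distrib_left mult_ac)
  also have "\<dots> = (\<Sum>k\<le>n. q ^ (k * (n + 1)) * well_poised_weight p q C x n k * h (C * q ^ k))"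
    by (rule sum.cong[OF refl], subst lagrange_weight[OF p q C x _ qn C2 Cx C_x]) auto
  finally show ?thesis .
qed

section \<open>Removing the genericity conditions\<close>

lemma isCont_zero_off_countable:
  fixes G :: "complex \<Rightarrow> complex"
  assumes "isCont G c" "countable B" "\<And>z. z \<notin> B \<Longrightarrow> G z = 0"
  shows "G c = 0"
proof (rule ccontr)
  assume "G c \<noteq> 0"
  then obtain e where e: "e > 0" "\<And>y. dist c y < e \<Longrightarrow> G y \<noteq> 0"
    using continuous_at_avoid[OF assms(1)] by blast
  have "ball c e \<subseteq> B"
  proof
    fix z assume "z \<in> ball c e"
    hence "G z \<noteq> 0" using e(2) by simp
    thus "z \<in> B" using assms(3) by blast
  qed
  thus False using uncountable_ball[OF e(1), of c] assms(2) countable_subset by blast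
qed

lemma isCont_theta_fact:
  assumes p: "norm p < 1" and q: "q \<noteq> 0" and "isCont g c" "g c \<noteq> 0"
  shows "isCont (\<lambda>z. theta_fact (g z) q p n) c"
proof (induction n)
  case (Suc n)
  have "isCont (\<lambda>z. mtheta (g z * q ^ n) p) c"
    by (rule isCont_o2[OF _ continuous_mtheta[OF p]]) (use assms in auto)
  with Suc show ?case unfolding theta_fact_Suc by (intro continuous_intros)
qed simp

lemma countable_theta_zeros_scaled:
  assumes p: "norm p < 1" and c: "c \<noteq> 0"
  shows "countable {z. z \<noteq> 0 \<and> mtheta (z * c) p = 0}"
    and "countable {z. z \<noteq> 0 \<and> mtheta (z ^ 2 * c) p = 0}"
proof -
  let ?Z = "{x. x \<noteq> 0 \<and> mtheta x p = 0}"
  have "z \<in> (\<lambda>x. x / c) ` ?Z" if "z \<noteq> 0" "mtheta (z * c) p = 0" for z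
    using that c by (intro image_eqI[of _ _ "z * c"]) auto
  hence "{z. z \<noteq> 0 \<and> mtheta (z * c) p = 0} \<subseteq> (\<lambda>x. x / c) ` ?Z" by auto
  thus "countable {z. z \<noteq> 0 \<and> mtheta (z * c) p = 0}"
    by (rule countable_subset) (intro countable_image countable_mtheta_zeros p)
  have "z \<in> (\<lambda>x. csqrt (x / c)) ` ?Z \<union> (\<lambda>x. - csqrt (x / c)) ` ?Z"
    if "z \<noteq> 0" "mtheta (z ^ 2 * c) p = 0" for z
  proof -
    have "(csqrt (z ^ 2 * c / c)) ^ 2 = z ^ 2" using c by (simp only: power2_csqrt) simp
    hence "z = csqrt (z ^ 2 * c / c) \<or> z = - csqrt (z ^ 2 * c / c)"
      by (metis power2_eq_iff)
    moreover have "z ^ 2 * c \<in> ?Z" using that c by simp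
    ultimately show ?thesis by blast
  qed
  hence "{z. z \<noteq> 0 \<and> mtheta (z ^ 2 * c) p = 0}
      \<subseteq> (\<lambda>x. csqrt (x / c)) ` ?Z \<union> (\<lambda>x. - csqrt (x / c)) ` ?Z" by auto
  thus "countable {z. z \<noteq> 0 \<and> mtheta (z ^ 2 * c) p = 0}"
    by (rule countable_subset) (intro countable_Un countable_image countable_mtheta_zeros p)
qed

text \<open>
  Both sides are continuous in \<open>C\<close> where the denominators do not vanish, and the exceptional values
  of \<open>C\<close> at which interpolation breaks down form a countable set. So the identity extends, for example,
  to \<open>C\<close> with \<open>mtheta (C ^ 2 * q) p = 0\<close>, where two nodes coincide although the sum makes sense.
\<close>

lemma elliptic_sum:
  assumes p: "norm p < 1" and q: "q \<noteq> 0" and C: "C \<noteq> 0" and x: "x \<noteq> 0"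
    and h: "theta_poly p n h"
    and C2: "mtheta (C ^ 2) p \<noteq> 0"
    and N: "theta_facts [C * x * q, C * q / x] q p n \<noteq> 0"
    and D: "\<And>k. k \<le> n \<Longrightarrow> theta_facts [q, C * x * q, C * q / x, C ^ 2 * q ^ (n + 1)] q p k \<noteq> 0"
  shows "theta_facts [q, C ^ 2 * q] q p n / theta_facts [C * x * q, C * q / x] q p n * h x
    = (\<Sum>k\<le>n. q ^ (k * (n + 1)) * well_poised_weight p q C x n k * h (C * q ^ k))"
proof -
  let ?L = "\<lambda>C. theta_facts [q, C ^ 2 * q] q p n / theta_facts [C * x * q, C * q / x] q p n * h x"
  let ?R = "\<lambda>C. \<Sum>k\<le>n. q ^ (k * (n + 1)) * well_poised_weight p q C x n k * h (C * q ^ k)"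
  define B where "B = {0} \<union> (\<Union>j\<le>2*n. {z. z \<noteq> 0 \<and> mtheta (z ^ 2 * q ^ j) p = 0})
    \<union> (\<Union>j\<le>n. {z. z \<noteq> 0 \<and> mtheta (z * (x * q ^ j)) p = 0})
    \<union> (\<Union>j\<le>n. {z. z \<noteq> 0 \<and> mtheta (z * (q ^ j / x)) p = 0})"
  have "countable B"
    unfolding B_def using q x
    by (intro countable_Un countable_UN countable_theta_zeros_scaled p) auto
  have qn: "theta_fact q q p n \<noteq> 0" using D[of n] by simp
  have off: "?L z - ?R z = 0" if "z \<notin> B" for z
  proof -
    have "?L z = ?R z"
      by (rule elliptic_sum_generic[OF p q _ x h qn]) (use that in \<open>auto simp: B_def mult_ac\<close>)
    thus ?thesis by simp
  qed
  have cont_tf: "isCont (\<lambda>z. theta_fact (z ^ 2 * q) q p k) C" "isCont (\<lambda>z. theta_fact (z * x * q) q p k) C"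
    "isCont (\<lambda>z. theta_fact (z * q / x) q p k) C" "isCont (\<lambda>z. theta_fact (z ^ 2) q p k) C"
    "isCont (\<lambda>z. theta_fact (z / x) q p k) C" "isCont (\<lambda>z. theta_fact (z * x) q p k) C"
    "isCont (\<lambda>z. theta_fact (z ^ 2 * q ^ (n + 1)) q p k) C" for k
    by ((rule isCont_theta_fact[OF p q], intro continuous_intros, use C q x in simp_all)+)
  have cont_th: "isCont (\<lambda>z. mtheta (z ^ 2 * q ^ (2 * k)) p) C" "isCont (\<lambda>z. mtheta (z ^ 2) p) C" for k
    by ((rule isCont_o2[OF _ continuous_mtheta[OF p]], intro continuous_intros, use C q in simp_all)+)
  have cont_h: "isCont (\<lambda>z. h (z * q ^ k)) C" for k
    by (rule isCont_o2[OF _ theta_poly_isCont[OF h]]) (use C q in auto)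
  have "isCont ?L C"
    using N by (simp, intro continuous_intros cont_tf) auto
  moreover have "isCont ?R C"
  proof (intro continuous_sum)
    fix k assume "k \<in> {..n}"
    hence "theta_facts [q, C * x * q, C * q / x, C ^ 2 * q ^ (n + 1)] q p k \<noteq> 0" using D by simp
    thus "isCont (\<lambda>z. q ^ (k * (n + 1)) * well_poised_weight p q z x n k * h (z * q ^ k)) C"
      unfolding well_poised_weight_def theta_facts_Cons theta_facts_Nil
      by (intro continuous_intros cont_tf cont_th cont_h) (use C2 in auto)
  qed
  ultimately have "isCont (\<lambda>z. ?L z - ?R z) C" by (rule continuous_diff)
  from isCont_zero_off_countable[OF this \<open>countable B\<close> off] show ?thesis by simp
qed

section \<open>Elliptic Askey-Wilson polynomials as theta polynomials\<close>

lemma qpoch_inf_square: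
  assumes p: "norm p < 1"
  shows "qpoch_inf x p * qpoch_inf (- x) p = qpoch_inf (x ^ 2) (p ^ 2)"
  unfolding qpoch_inf_def
  by (subst prodinf_mult[OF convergent_prod_qpoch[OF p] convergent_prod_qpoch[OF p]])
     (simp add: algebra_simps power2_eq_square power_mult_distrib)

lemma norm_square_less_one: "norm (p :: complex) < 1 \<Longrightarrow> norm (p ^ 2) < 1"
  by (simp add: norm_power power_less_one_iff)

lemma mtheta_square:
  assumes p: "norm p < 1"
  shows "mtheta x p * mtheta (- x) p = mtheta (x ^ 2) (p ^ 2)"
proof -
  have "mtheta x p * mtheta (- x) p
    = (qpoch_inf x p * qpoch_inf (- x) p) * (qpoch_inf (p / x) p * qpoch_inf (- (p / x)) p)"
    by (simp add: mtheta_eq_qpoch[OF p])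
  thus ?thesis
    by (simp add: qpoch_inf_square[OF p] mtheta_eq_qpoch[OF norm_square_less_one[OF p]] power_divide)
qed

text \<open>
  The zeros \<open>y ^ 2 = -1\<close> of \<open>aw_P p\<close> show which bracket it must be: the one with \<open>\<i>\<close>.
\<close>

lemma aw_P_linear:
  assumes p: "norm p < 1"
  shows "(\<lambda>y. aw_P p y / y) \<in> theta_linear p"
proof (rule theta_linear_cmult[OF theta_bracket_linear[OF p, of \<i>]])
  fix y :: complex assume y: "y \<noteq> 0"
  have "mtheta (\<i> / y) p = - (\<i> / y) * mtheta (- (\<i> * y)) p"
  proof -
    have e: "1 / (- (\<i> * y)) = \<i> / y" using y by (simp add: field_simps)
    show ?thesis using mtheta_inverse[OF p, of "- (\<i> * y)"] y unfolding e by simp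
  qed
  moreover have "\<i> * (a * (\<i> * b)) = - (a * b)" for a b
  proof -
    have "\<i> * (a * (\<i> * b)) = (\<i> * \<i>) * (a * b)" by (simp only: mult_ac)
    thus ?thesis by simp
  qed
  ultimately have "theta_bracket p \<i> y = - (mtheta (\<i> * y) p * mtheta (- (\<i> * y)) p) / y"
    using y by (simp add: theta_bracket_def)
  also have "mtheta (\<i> * y) p * mtheta (- (\<i> * y)) p = mtheta (- (y ^ 2)) (p ^ 2)"
    by (subst mtheta_square[OF p]) (simp add: power_mult_distrib)
  finally show "aw_P p y / y = - qpoch_inf (- p) p * theta_bracket p \<i> y"
    by (simp add: aw_P_def)
qed simp

text \<open>
  For \<open>p \<noteq> 0\<close> the zeros of \<open>aw_Q p\<close> lie at \<open>y ^ 2 = - p\<close>, up to powers of \<open>p ^ 2\<close>, so the bracket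
  with \<open>\<i> * csqrt p\<close> serves. For \<open>p = 0\<close> these zeros degenerate to \<open>0\<close> and \<open>\<infinity>\<close>; the quotient is then the constant
  \<open>1\<close>, which satisfies the three-term relation because the bracket is a difference.
\<close>

lemma aw_Q_linear:
  assumes p: "norm p < 1"
  shows "(\<lambda>y. aw_Q p y / y) \<in> theta_linear p"
proof (cases "p = 0")
  case False
  define a where "a = \<i> * csqrt p"
  have a2: "a ^ 2 = - p" by (simp add: a_def power_mult_distrib)
  have a: "a \<noteq> 0" using False by (simp add: a_def)
  have pa: "p / a = - a" using a a2 by (simp add: field_simps power2_eq_square)
  show ?thesis
  proof (rule theta_linear_cmult[OF theta_bracket_linear[OF p a]])
    fix y :: complex assume y: "y \<noteq> 0"
    have "p / (a * y) = p / a / y" "p / (a / y) = p / a * y" by simp_all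
    hence e: "p / (a * y) = - (a / y)" "p * y / a = - (a * y)"
      unfolding pa by simp_all
    have "a * theta_bracket p a y = (qpoch_inf (a * y) p * qpoch_inf (- (a * y)) p)
        * (qpoch_inf (a / y) p * qpoch_inf (- (a / y)) p)"
      using a by (simp add: theta_bracket_def mtheta_eq_qpoch[OF p] e)
    also have "\<dots> = mtheta (- p * y ^ 2) (p ^ 2)"
    proof -
      have "p ^ 2 / (- p * y ^ 2) = - p / y ^ 2" using False by (simp add: power2_eq_square)
      thus ?thesis
        by (simp add: qpoch_inf_square[OF p] mtheta_eq_qpoch[OF norm_square_less_one[OF p]]
            power_mult_distrib power_divide a2)
    qed
    finally show "aw_Q p y / y = qpoch_inf (- p) p * a * theta_bracket p a y"
      using y by (simp add: aw_Q_def)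
  qed
next
  case True
  have "theta_bracket p z w + theta_bracket p w y + theta_bracket p y z = 0"
    if "y \<noteq> 0" "z \<noteq> 0" "w \<noteq> 0" for y z w
    using that True by (simp add: theta_bracket_zero)
  hence "(\<lambda>_. 1) \<in> theta_linear p" by (auto simp: theta_linear_def)
  thus ?thesis
  proof (rule theta_linear_cmult)
    fix y :: complex assume "y \<noteq> 0"
    thus "aw_Q p y / y = mtheta 0 0 * qpoch_inf 0 0 * 1" using True by (simp add: aw_Q_def)
  qed
qed

lemma elliptic_aw_theta_poly:
  assumes p: "norm p < 1" and f: "f \<in> elliptic_aw M p"
  obtains g where "theta_poly p M g" "\<And>y. y \<noteq> 0 \<Longrightarrow> f y = y ^ M * g y"
proof -
  obtain c where c: "\<And>y. y \<noteq> 0 \<Longrightarrow> f y = (\<Sum>k\<le>M. c k * aw_P p y ^ k * aw_Q p y ^ (M - k))"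
    using f by (auto simp: elliptic_aw_def)
  \<comment> \<open>The conditional keeps every summand a theta polynomial of degree \<open>M\<close>, for all \<open>k\<close>.\<close>
  define g where "g = (\<lambda>y. \<Sum>k\<le>M. if k \<le> M then c k * ((aw_P p y / y) ^ k * (aw_Q p y / y) ^ (M - k)) else 0)"
  have t: "theta_poly p M (\<lambda>y. c * ((aw_P p y / y) ^ k * (aw_Q p y / y) ^ (M - k)))" if "k \<le> M" for k c
    using theta_poly_cmult[OF theta_poly_mult[OF theta_poly_power[OF aw_P_linear[OF p], of k]
          theta_poly_power[OF aw_Q_linear[OF p], of "M - k"]]] that by simp
  have "theta_poly p M g"
    unfolding g_def
  proof (rule theta_poly_sum)
    fix k
    show "theta_poly p M (\<lambda>y. if k \<le> M then c k * ((aw_P p y / y) ^ k * (aw_Q p y / y) ^ (M - k)) else 0)"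
      using t[of k "c k"] t[of 0 0] by (cases "k \<le> M") simp_all
  qed
  moreover have "f y = y ^ M * g y" if y: "y \<noteq> 0" for y
  proof -
    have "c k * aw_P p y ^ k * aw_Q p y ^ (M - k)
       = y ^ M * (c k * ((aw_P p y / y) ^ k * (aw_Q p y / y) ^ (M - k)))" if "k \<le> M" for k
    proof -
      have "y ^ M = y ^ k * y ^ (M - k)" using that by (simp flip: power_add)
      thus ?thesis using y by (simp add: power_divide)
    qed
    thus ?thesis
      unfolding c[OF y] g_def sum_distrib_left by (intro sum.cong) auto
  qed
  ultimately show ?thesis by (rule that)
qed

lemma theta_poly_pair:
  assumes p: "norm p < 1" and "q \<noteq> 0" "a \<noteq> 0"
  shows "theta_poly p n (\<lambda>y. theta_facts [a * y, a / y] q p n)"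
proof (induction n)
  case 0 thus ?case using theta_poly.const[of p 1] by simp
next
  case (Suc n)
  let ?a = "a * q ^ n"
  have "?a \<noteq> 0" using assms by simp
  from theta_poly_cmult[OF theta_poly.linear_mult[OF theta_bracket_linear[OF p this] Suc], of ?a]
  have "theta_poly p (Suc n) (\<lambda>y. ?a * (theta_bracket p ?a y * theta_facts [a * y, a / y] q p n))" .
  moreover have "?a * (theta_bracket p ?a y * theta_facts [a * y, a / y] q p n)
     = theta_facts [a * y, a / y] q p (Suc n)" for y
    using assms by (simp add: theta_bracket_def theta_fact_Suc mult_ac)
  ultimately show ?case by simp
qed

text \<open>
  The factorial starting at \<open>b = a / (C * q ^ k)\<close> with \<open>k + n\<close> factors can be split after \<open>k\<close> or
  after \<open>n\<close> factors. Reflecting the two blocks of length \<open>k\<close> yields the claim; their reflection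
  prefactors differ by \<open>q ^ (k * n)\<close>.
\<close>

lemma theta_fact_shift_swap:
  assumes p: "norm p < 1" and q: "q \<noteq> 0" and a: "a \<noteq> 0" and C: "C \<noteq> 0"
  shows "theta_fact (C * q / a) q p k * theta_fact (a / C) q p n
    = q ^ (k * n) * theta_fact (a / (C * q ^ k)) q p n * theta_fact (C * q powi (1 - int n) / a) q p k"
proof -
  let ?b = "a / (C * q ^ k)" and ?z = "C * q / a" and ?w = "C * q powi (1 - int n) / a"
  let ?pre = "\<Prod>i<k. - (1 / (?z * q ^ i))"
  have w: "?w = ?z / q ^ n" using q by (simp add: power_int_diff)
  have 1: "theta_fact ?b q p k = ?pre * theta_fact ?z q p k"
    by (rule theta_fact_reflect[OF p q]) (use q a C in auto)
  have "theta_fact (?b * q ^ n) q p k = (\<Prod>i<k. - (1 / (?w * q ^ i))) * theta_fact ?w q p k"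
    by (rule theta_fact_reflect[OF p q]) (use q a C in \<open>auto simp: w\<close>)
  also have "(\<Prod>i<k. - (1 / (?w * q ^ i))) = (\<Prod>i<k. q ^ n * - (1 / (?z * q ^ i)))"
    using q by (simp add: w mult_ac)
  also have "\<dots> = q ^ (k * n) * ?pre"
    by (simp only: prod.distrib prod_constant card_lessThan power_mult[symmetric] mult.commute[of k])
  finally have 2: "theta_fact (?b * q ^ n) q p k = q ^ (k * n) * ?pre * theta_fact ?w q p k" .
  have "theta_fact ?b q p k * theta_fact (?b * q ^ k) q p n
      = theta_fact ?b q p n * theta_fact (?b * q ^ n) q p k"
    by (simp only: theta_fact_add[symmetric] add.commute)
  moreover have "?b * q ^ k = a / C" using q by simp
  ultimately have "?pre * (theta_fact ?z q p k * theta_fact (a / C) q p n)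
     = ?pre * (q ^ (k * n) * theta_fact ?b q p n * theta_fact ?w q p k)"
    unfolding 1 2 by (simp only: mult_ac)
  moreover have "?pre \<noteq> 0" using q a C by simp
  ultimately show ?thesis by simp
qed

text \<open>
  The factors with \<open>a = A i\<close> in the summand are, up to a power of \<open>q\<close>, the values at the node
  \<open>C * q ^ k\<close> of the corresponding factor on the left, normalised by its value at \<open>C\<close>.
\<close>

lemma theta_facts_ratio:
  assumes p: "norm p < 1" and q: "q \<noteq> 0" and a: "a \<noteq> 0" and C: "C \<noteq> 0"
    and n: "theta_facts [a * C, a / C] q p n \<noteq> 0"
    and k: "theta_facts [C * q powi (1 - int n) / a, a * C] q p k \<noteq> 0"
  shows "theta_facts [a * C * q ^ n, C * q / a] q p k / theta_facts [C * q powi (1 - int n) / a, a * C] q p k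
    = q ^ (k * n) * (theta_facts [a * (C * q ^ k), a / (C * q ^ k)] q p n / theta_facts [a * C, a / C] q p n)"
proof -
  have "theta_fact (a * C) q p n * theta_fact (a * C * q ^ n) q p k
      = theta_fact (a * C) q p k * theta_fact (a * C * q ^ k) q p n"
    by (simp only: theta_fact_add[symmetric] add.commute)
  hence 1: "theta_fact (a * C * q ^ n) q p k / theta_fact (a * C) q p k
      = theta_fact (a * (C * q ^ k)) q p n / theta_fact (a * C) q p n"
    using n k by (simp add: frac_eq_eq mult_ac)
  have 2: "theta_fact (C * q / a) q p k / theta_fact (C * q powi (1 - int n) / a) q p k
      = q ^ (k * n) * theta_fact (a / (C * q ^ k)) q p n / theta_fact (a / C) q p n"
    using theta_fact_shift_swap[OF p q a C, of k n] n k by (simp add: frac_eq_eq)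
  have "theta_facts [a * C * q ^ n, C * q / a] q p k / theta_facts [C * q powi (1 - int n) / a, a * C] q p k
     = (theta_fact (a * C * q ^ n) q p k / theta_fact (a * C) q p k)
       * (theta_fact (C * q / a) q p k / theta_fact (C * q powi (1 - int n) / a) q p k)"
    by simp
  also have "\<dots> = q ^ (k * n) * (theta_facts [a * (C * q ^ k), a / (C * q ^ k)] q p n / theta_facts [a * C, a / C] q p n)"
    unfolding 1 2 by simp
  finally show ?thesis .
qed

section \<open>The summation formula\<close>

theorem theorem1p13:
  fixes p q C x :: complex and A :: "nat \<Rightarrow> complex"
    and N :: "nat \<Rightarrow> nat" and m NN :: nat and f :: "complex \<Rightarrow> complex"
  assumes "norm p < 1"
    and "f \<in> elliptic_aw (N 0) p"
    and "NN = (\<Sum>i=0..m. N i)"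
    and "q \<noteq> 0" and "C \<noteq> 0" and "x \<noteq> 0" and "\<forall>i\<in>{1..m}. A i \<noteq> 0"
    and "theta_facts [C * x * q, C * q / x] q p NN \<noteq> 0"
    and "\<forall>i\<in>{1..m}. theta_facts [A i * C, A i / C] q p (N i) \<noteq> 0"
    and "mtheta (C ^ 2) p \<noteq> 0"
    and "\<forall>k\<le>NN. theta_facts [q, C * x * q, C * q / x, C ^ 2 * q ^ (NN + 1)] q p k \<noteq> 0"
    and "\<forall>k\<le>NN. \<forall>i\<in>{1..m}.
           theta_facts [C * q powi (1 - int (N i)) / A i, A i * C] q p k \<noteq> 0"
  shows "(C / x) ^ N 0
           * (theta_facts [q, C ^ 2 * q] q p NN / theta_facts [C * x * q, C * q / x] q p NN)
           * (\<Prod>i=1..m. theta_facts [A i * x, A i / x] q p (N i)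
                       / theta_facts [A i * C, A i / C] q p (N i))
           * f x
       = (\<Sum>k=0..NN. q ^ k
           * (mtheta (C ^ 2 * q ^ (2 * k)) p / mtheta (C ^ 2) p)
           * (theta_facts [C ^ 2, C / x, C * x, q powi (- int NN)] q p k
              / theta_facts [q, C * x * q, C * q / x, C ^ 2 * q ^ (NN + 1)] q p k)
           * f (C * q ^ k)
           * (\<Prod>i=1..m. theta_facts [A i * C * q ^ N i, C * q / A i] q p k
                       / theta_facts [C * q powi (1 - int (N i)) / A i, A i * C] q p k))"
proof -
  note p = assms(1) and q = assms(4) and C = assms(5) and x = assms(6)
  obtain g where g: "theta_poly p (N 0) g" and fg: "\<And>y. y \<noteq> 0 \<Longrightarrow> f y = y ^ N 0 * g y"
    using elliptic_aw_theta_poly[OF p assms(2)] by blast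
  let ?A = "\<lambda>i y. theta_facts [A i * y, A i / y] q p (N i)"
  let ?D = "\<Prod>i=1..m. ?A i C"
  let ?w = "well_poised_weight p q C x NN"
  let ?K = "theta_facts [q, C ^ 2 * q] q p NN / theta_facts [C * x * q, C * q / x] q p NN"
  \<comment> \<open>Each theta pair counts as one linear factor, so \<open>h\<close> has degree \<open>NN\<close>.\<close>
  define h where "h = (\<lambda>y. g y * (\<Prod>i=1..m. ?A i y))"
  have NN: "NN = N 0 + (\<Sum>i=1..m. N i)"
    by (simp add: assms(3) sum.atLeast_Suc_atMost)
  have "theta_poly p (\<Sum>i=1..m. N i) (\<lambda>y. \<Prod>i=1..m. ?A i y)"
    using assms(7) by (intro theta_poly_prod theta_poly_pair p q) auto
  from theta_poly_mult[OF g this] have h: "theta_poly p NN h"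
    by (simp add: h_def NN)
  have "?K * h x = (\<Sum>k\<le>NN. q ^ (k * (NN + 1)) * ?w k * h (C * q ^ k))"
    using assms(8,10,11) by (intro elliptic_sum[OF p q C x h]) auto
  moreover have "(C / x) ^ N 0 * ?K * (\<Prod>i=1..m. ?A i x / ?A i C) * f x = C ^ N 0 / ?D * (?K * h x)"
    using x by (simp only: fg[OF x] h_def prod_dividef power_divide) (simp add: field_simps)
  moreover have "q ^ k * (mtheta (C ^ 2 * q ^ (2 * k)) p / mtheta (C ^ 2) p)
           * (theta_facts [C ^ 2, C / x, C * x, q powi (- int NN)] q p k
              / theta_facts [q, C * x * q, C * q / x, C ^ 2 * q ^ (NN + 1)] q p k)
           * f (C * q ^ k)
           * (\<Prod>i=1..m. theta_facts [A i * C * q ^ N i, C * q / A i] q p k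
                       / theta_facts [C * q powi (1 - int (N i)) / A i, A i * C] q p k)
       = C ^ N 0 / ?D * (q ^ (k * (NN + 1)) * ?w k * h (C * q ^ k))" (is "?lhs = _") if k: "k \<le> NN" for k
  proof -
    have "(\<Prod>i=1..m. theta_facts [A i * C * q ^ N i, C * q / A i] q p k
                       / theta_facts [C * q powi (1 - int (N i)) / A i, A i * C] q p k)
      = (\<Prod>i=1..m. q ^ (k * N i) * (?A i (C * q ^ k) / ?A i C))"
      using assms(7,9,12) k by (intro prod.cong refl theta_facts_ratio p q C) auto
    also have "\<dots> = q ^ (k * (\<Sum>i=1..m. N i)) * ((\<Prod>i=1..m. ?A i (C * q ^ k)) / ?D)"
      by (simp only: prod.distrib prod_dividef power_sum[symmetric] sum_distrib_left)
    finally have pr: "(\<Prod>i=1..m. theta_facts [A i * C * q ^ N i, C * q / A i] q p k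
                       / theta_facts [C * q powi (1 - int (N i)) / A i, A i * C] q p k)
      = q ^ (k * (\<Sum>i=1..m. N i)) * ((\<Prod>i=1..m. ?A i (C * q ^ k)) / ?D)" .
    have fk: "f (C * q ^ k) = C ^ N 0 * q ^ (k * N 0) * g (C * q ^ k)"
      using C q by (simp add: fg power_mult_distrib power_mult)
    have qk: "q ^ (k * (NN + 1)) = q ^ k * q ^ (k * N 0) * q ^ (k * (\<Sum>i=1..m. N i))"
      unfolding NN by (simp add: distrib_left power_add mult_ac)
    have "?lhs = q ^ k * ?w k * f (C * q ^ k) * (q ^ (k * (\<Sum>i=1..m. N i)) * ((\<Prod>i=1..m. ?A i (C * q ^ k)) / ?D))"
      unfolding pr well_poised_weight_def by (simp only: mult.assoc)
    also have "\<dots> = C ^ N 0 / ?D * (q ^ (k * (NN + 1)) * ?w k * h (C * q ^ k))"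
      unfolding fk qk h_def by (simp only: divide_inverse mult_ac)
    finally show ?thesis .
  qed
  ultimately show ?thesis
    by (simp only: atLeast0AtMost sum_distrib_left) (auto intro!: sum.cong)
qed

end
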